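(* Let $\&$ be a continuous t-norm. Then the $[0,1]$-enriched category $(\mathbb{E}^1,P)$ is Cauchy complete if and only if $\&$ is not isomorphic to the {\L}ukasiewicz t-norm on $[0,1]$.
   Context: A t-norm is a commutative, associative operation $\&:[0,1]\times[0,1]\to[0,1]$, monotone in each variable, with $x\,\&\,1=x$. Its residuated implication is $x\rightarrow y=\sup\{w\in[0,1] : x\,\&\,w\le y\}$. The {\L}ukasiewicz t-norm is $(a,b)\mapsto\max(a+b-1,0)$; $\&$ is isomorphic to it if there is a strictly increasing bijection $\varphi:[0,1]\to[0,1]$ with $\varphi(a\,\&\,b)=\max(\varphi(a)+\varphi(b)-1,0)$ for all $a,b\in[0,1]$. Fuzzy numbers: $\mathbb{E}^1$ is the set of all $u:\mathbb{R}\to[0,1]$ such that (1) $u(x_0)=1$ for some $x_0$; (2) $u(\lambda x+(1-\lambda)y)\ge\min\{u(x),u(y)\}$ for all $x,y\in\mathbb{R}$, $\lambda\in[0,1]$; (3) $u$ is upper semicontinuous; (4) $[u]_0=\overline{\{x: u(x)>0\}}$ is compact. Write $[u]_0=[u_0^-,u_0^+]$ and $[u]_1=\{x:u(x)=1\}=[u_1^-,u_1^+]$. The left part $u^\ell$ and right part $u^r$ are functions $\mathbb{R}\to[0,1]$: $u^\ell(x)=0$ for $x<u_0^-$, $u^\ell(x)=u(x)$ for $x\in[u_0^-,u_1^-]$, $u^\ell(x)=1$ for $x>u_1^-$; and $u^r(x)=1$ for $x<u_1^-$, $u^r(x)=u(x)$ for $x\in[u_1^-,u_0^+]$, $u^r(x)=0$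 for $x>u_0^+$. Fuzzy order: $P(u,v)=\inf_{x\in\mathbb{R}}\left[(v^\ell(x)\rightarrow u^\ell(x))\wedge(u^r(x)\rightarrow v^r(x))\right]$ for $u,v\in\mathbb{E}^1$. A $[0,1]$-enriched category is a set $X$ with a map $X(\cdot,\cdot):X\times X\to[0,1]$ such that $X(x,x)=1$ and $X(y,z)\,\&\,X(x,y)\le X(x,z)$. The pair $(\mathbb{E}^1,P)$ is such a category. A net $\{x_i\}_{i\in D}$ in $X$ is Cauchy if $\sup_{i\in D}\inf_{j,k\ge i}X(x_j,x_k)=1$. An element $a\in X$ is a bilimit of $\{x_i\}_{i\in D}$ if for all $x\in X$: $\sup_{i\in D}\inf_{j\ge i}X(x,x_j)=X(x,a)$ and $\sup_{i\in D}\inf_{j\ge i}X(x_j,x)=X(a,x)$. $X$ is Cauchy complete if every Cauchy net in $X$ has a bilimit. *)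

theory Defs
  imports "HOL-Analysis.Analysis"
begin

section \<open>Triangular norms\<close>

text \<open>Operations on the unit interval are functions on \<open>real\<close> that are only constrained on
  \<open>{0..1}\<close>; every use below is guarded accordingly.\<close>

definition t_norm :: "(real \<Rightarrow> real \<Rightarrow> real) \<Rightarrow> bool" where
  "t_norm T \<longleftrightarrow>
     (\<forall>x\<in>{0..1}. \<forall>y\<in>{0..1}. T x y \<in> {0..1}) \<and>
     (\<forall>x\<in>{0..1}. \<forall>y\<in>{0..1}. T x y = T y x) \<and>
     (\<forall>x\<in>{0..1}. \<forall>y\<in>{0..1}. \<forall>z\<in>{0..1}. T (T x y) z = T x (T y z)) \<and>
     (\<forall>x\<in>{0..1}. \<forall>y\<in>{0..1}. \<forall>z\<in>{0..1}. x \<le> y \<longrightarrow> T x z \<le> T y z \<and> T z x \<le> T z y) \<and>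
     (\<forall>x\<in>{0..1}. T x 1 = x)"

definition continuous_t_norm :: "(real \<Rightarrow> real \<Rightarrow> real) \<Rightarrow> bool" where
  "continuous_t_norm T \<longleftrightarrow>
     t_norm T \<and> continuous_on ({0..1} \<times> {0..1}) (\<lambda>p. T (fst p) (snd p))"

definition residuum :: "(real \<Rightarrow> real \<Rightarrow> real) \<Rightarrow> real \<Rightarrow> real \<Rightarrow> real" where
  "residuum T x y = Sup {w \<in> {0..1}. T x w \<le> y}"

definition lukasiewicz :: "real \<Rightarrow> real \<Rightarrow> real" where
  "lukasiewicz a b = max (a + b - 1) 0"

definition isomorphic_lukasiewicz :: "(real \<Rightarrow> real \<Rightarrow> real) \<Rightarrow> bool" where
  "isomorphic_lukasiewicz T \<longleftrightarrow>
     (\<exists>\<phi>. bij_betw \<phi> {0..1} {0..1} \<and> strict_mono_on {0..1} \<phi> \<and>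
          (\<forall>a\<in>{0..1}. \<forall>b\<in>{0..1}. \<phi> (T a b) = lukasiewicz (\<phi> a) (\<phi> b)))"


section \<open>Fuzzy numbers\<close>

definition upper_semicontinuous :: "(real \<Rightarrow> real) \<Rightarrow> bool" where
  "upper_semicontinuous u \<longleftrightarrow> (\<forall>x c. u x < c \<longrightarrow> (\<forall>\<^sub>F y in nhds x. u y < c))"

definition level0 :: "(real \<Rightarrow> real) \<Rightarrow> real set" where
  "level0 u = closure {x. u x > 0}"

definition level1 :: "(real \<Rightarrow> real) \<Rightarrow> real set" where
  "level1 u = {x. u x = 1}"

definition fuzzy_numbers :: "(real \<Rightarrow> real) set" where
  "fuzzy_numbers = {u.
     (\<forall>x. u x \<in> {0..1}) \<and>
     (\<exists>x. u x = 1) \<and>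
     (\<forall>x y. \<forall>l\<in>{0..1}. u (l * x + (1 - l) * y) \<ge> min (u x) (u y)) \<and>
     upper_semicontinuous u \<and>
     compact (level0 u)}"

text \<open>For a fuzzy number \<open>u\<close> both level sets are nonempty compact intervals, with end points
  \<open>Inf (level0 u)\<close>, \<open>Sup (level0 u)\<close> and \<open>Inf (level1 u)\<close>, \<open>Sup (level1 u)\<close>;
  see \<open>level0_eq_interval\<close> and \<open>level1_eq_interval\<close> below.\<close>

lemma
  assumes u: "u \<in> fuzzy_numbers"
  shows level1_eq_interval: "level1 u = {Inf (level1 u)..Sup (level1 u)}"
    and level0_eq_interval: "level0 u = {Inf (level0 u)..Sup (level0 u)}"
    and level1_subset_level0: "level1 u \<subseteq> level0 u"
    and level1_nonempty: "level1 u \<noteq> {}"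
proof -
  have range: "u x \<in> {0..1}" for x using u unfolding fuzzy_numbers_def by blast
  have conv: "min (u x) (u y) \<le> u (l * x + (1 - l) * y)" if "0 \<le> l" "l \<le> 1" for x y l
    using u that unfolding fuzzy_numbers_def by auto
  have usc: "upper_semicontinuous u" and c0: "compact (level0 u)"
    using u unfolding fuzzy_numbers_def by blast+
  show sub: "level1 u \<subseteq> level0 u"
    using closure_subset unfolding level1_def level0_def by force
  show ne: "level1 u \<noteq> {}"
    using u unfolding fuzzy_numbers_def level1_def by blast
  have interval: "S = {Inf S..Sup S}" if "convex S" "compact S" "S \<noteq> {}" for S :: "real set"
  proof -
    from that obtain a b where "S = {a..b}"
      using connected_compact_interval_1 convex_connected by blast
    with \<open>S \<noteq> {}\<close> show ?thesis by simp
  qed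
  have conv_in: "u (p * x + q * y) \<ge> min (u x) (u y)" if "0 \<le> p" "0 \<le> q" "p + q = 1" for x y p q
  proof -
    have "q = 1 - p" using that by simp
    then show ?thesis using conv[of p x y] that(1,2) by simp
  qed
  have "convex {x. u x > 0}"
    unfolding convex_def
  proof (intro ballI allI impI)
    fix x y p q :: real
    assume "x \<in> {x. u x > 0}" "y \<in> {x. u x > 0}" "0 \<le> p" "0 \<le> q" "p + q = 1"
    with conv_in[of p q x y] show "p *\<^sub>R x + q *\<^sub>R y \<in> {x. u x > 0}" by simp
  qed
  then have "convex (level0 u)" unfolding level0_def by (rule convex_closure)
  then show "level0 u = {Inf (level0 u)..Sup (level0 u)}"
    using c0 sub ne by (intro interval) auto
  have "convex (level1 u)"
    unfolding convex_def
  proof (intro ballI allI impI)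
    fix x y p q :: real
    assume "x \<in> level1 u" "y \<in> level1 u" "0 \<le> p" "0 \<le> q" "p + q = 1"
    with conv_in[of p q x y] range[of "p * x + q * y"] show "p *\<^sub>R x + q *\<^sub>R y \<in> level1 u"
      by (simp add: level1_def)
  qed
  moreover have "closed (level1 u)"
  proof -
    have eq: "- level1 u = {x. u x < 1}"
      unfolding level1_def using range by (auto simp: less_le)
    have "open {x. u x < 1}"
    proof (subst open_subopen, intro ballI)
      fix x assume "x \<in> {x. u x < 1}"
      then have "eventually (\<lambda>y. u y < 1) (nhds x)"
        using usc unfolding upper_semicontinuous_def by simp
      then show "\<exists>U. open U \<and> x \<in> U \<and> U \<subseteq> {x. u x < 1}"
        unfolding eventually_nhds by blast
    qed
    then show ?thesis using eq by (simp add: closed_def)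
  qed
  then have "compact (level1 u)"
    using compact_Int_closed[OF c0] sub by (metis inf.absorb2)
  ultimately show "level1 u = {Inf (level1 u)..Sup (level1 u)}"
    using ne by (intro interval)
qed

definition left_part :: "(real \<Rightarrow> real) \<Rightarrow> real \<Rightarrow> real" where
  "left_part u x =
     (if x < Inf (level0 u) then 0 else if x \<le> Inf (level1 u) then u x else 1)"

definition right_part :: "(real \<Rightarrow> real) \<Rightarrow> real \<Rightarrow> real" where
  "right_part u x =
     (if x < Inf (level1 u) then 1 else if x \<le> Sup (level0 u) then u x else 0)"

definition fuzzy_order ::
    "(real \<Rightarrow> real \<Rightarrow> real) \<Rightarrow> (real \<Rightarrow> real) \<Rightarrow> (real \<Rightarrow> real) \<Rightarrow> real" where
  "fuzzy_order T u v =
     (INF x. min (residuum T (left_part v x) (left_part u x))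
                 (residuum T (right_part u x) (right_part v x)))"


section \<open>Enriched categories, nets and Cauchy completeness\<close>

definition enriched_category ::
    "(real \<Rightarrow> real \<Rightarrow> real) \<Rightarrow> 'a set \<Rightarrow> ('a \<Rightarrow> 'a \<Rightarrow> real) \<Rightarrow> bool" where
  "enriched_category T X hom \<longleftrightarrow>
     (\<forall>x\<in>X. \<forall>y\<in>X. hom x y \<in> {0..1}) \<and>
     (\<forall>x\<in>X. hom x x = 1) \<and>
     (\<forall>x\<in>X. \<forall>y\<in>X. \<forall>z\<in>X. T (hom y z) (hom x y) \<le> hom x z)"

lemma enriched_category_fuzzy_numbers:
  assumes T: "continuous_t_norm T"
  shows "enriched_category T fuzzy_numbers (fuzzy_order T)"
proof -
  have tn: "t_norm T" and cont: "continuous_on ({0..1} \<times> {0..1}) (\<lambda>p. T (fst p) (snd p))"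
    using T unfolding continuous_t_norm_def by auto
  have cl: "T x y \<in> {0..1}" if "x \<in> {0..1}" "y \<in> {0..1}" for x y
    using tn that unfolding t_norm_def by blast
  have com: "T x y = T y x" if "x \<in> {0..1}" "y \<in> {0..1}" for x y
    using tn that unfolding t_norm_def by blast
  have ass: "T (T x y) z = T x (T y z)" if "x \<in> {0..1}" "y \<in> {0..1}" "z \<in> {0..1}" for x y z
    using tn that unfolding t_norm_def by blast
  have mono1: "T x z \<le> T y z" and mono2: "T z x \<le> T z y"
    if "x \<in> {0..1}" "y \<in> {0..1}" "z \<in> {0..1}" "x \<le> y" for x y z
    using tn that unfolding t_norm_def by blast+
  have unit: "T x 1 = x" if "x \<in> {0..1}" for x
    using tn that unfolding t_norm_def by blast
  have zero: "T x 0 = 0" if "x \<in> {0..1}" for x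
  proof -
    have "T x 0 = T 0 x" using com that by simp
    also have "\<dots> \<le> T 0 1" using that by (intro mono2) auto
    also have "\<dots> = 0" using unit[of 0] by simp
    finally show ?thesis using cl[of x 0] that by simp
  qed

  have res_ne: "0 \<in> {w \<in> {0..1}. T x w \<le> y}" if "x \<in> {0..1}" "y \<in> {0..1}" for x y
    using zero that by simp
  have res_bdd: "bdd_above {w \<in> {0..1}. T x w \<le> y}" for x y
    by (rule bdd_aboveI[of _ 1]) simp
  have res_closed: "closed {w \<in> {0..1}. T x w \<le> y}" if "x \<in> {0..1}" for x y
  proof -
    have "continuous_on {0..1} (\<lambda>w. (x, w))" by (intro continuous_intros)
    then have "continuous_on {0..1} (\<lambda>w. T x w)"
      using continuous_on_compose2[OF cont, of "{0..1}" "\<lambda>w. (x, w)"] that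
      by (simp add: image_subset_iff)
    then show ?thesis
      by (intro continuous_on_closed_Collect_le) (auto intro: continuous_intros)
  qed
  have res_in: "residuum T x y \<in> {0..1}" and res_le: "T x (residuum T x y) \<le> y"
    if "x \<in> {0..1}" "y \<in> {0..1}" for x y
  proof -
    have "residuum T x y \<in> {w \<in> {0..1}. T x w \<le> y}"
      unfolding residuum_def using res_ne[OF that] res_bdd res_closed[OF that(1)]
      by (intro closed_contains_Sup) blast+
    then show "residuum T x y \<in> {0..1}" "T x (residuum T x y) \<le> y" by auto
  qed
  have res_greatest: "w \<le> residuum T x y" if "w \<in> {0..1}" "T x w \<le> y" for w x y
    unfolding residuum_def by (rule cSup_upper[OF _ res_bdd]) (use that in simp)
  have res_refl: "residuum T x x = 1" if "x \<in> {0..1}" for x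
    using res_greatest[of 1 x x] unit[OF that] res_in[OF that that] by simp
  have T_res: "T a b \<le> residuum T x z"
    if I: "x \<in> {0..1}" "y \<in> {0..1}" "z \<in> {0..1}" "a \<in> {0..1}" "b \<in> {0..1}"
      and ab: "a \<le> residuum T x y" "b \<le> residuum T y z" for x y z a b
  proof (rule res_greatest)
    show "T a b \<in> {0..1}" using I cl by blast
    have "T x a \<le> T x (residuum T x y)" using I ab res_in by (intro mono2) auto
    also have "\<dots> \<le> y" using I res_le by blast
    finally have xa: "T x a \<le> y" .
    have "T x (T a b) = T (T x a) b" using ass I by simp
    also have "\<dots> \<le> T y b" using xa I cl by (intro mono1) auto
    also have "\<dots> \<le> T y (residuum T y z)" using I ab res_in by (intro mono2) auto
    also have "\<dots> \<le> z" using I res_le by blast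
    finally show "T x (T a b) \<le> z" .
  qed

  have part: "left_part u x \<in> {0..1}" "right_part u x \<in> {0..1}" if "u \<in> fuzzy_numbers" for u x
    using that unfolding fuzzy_numbers_def left_part_def right_part_def by auto
  define m where "m u v x = min (residuum T (left_part v x) (left_part u x))
      (residuum T (right_part u x) (right_part v x))" for u v x
  have P: "fuzzy_order T u v = (INF x. m u v x)" for u v
    unfolding fuzzy_order_def m_def ..
  have m_in: "m u v x \<in> {0..1}" if "u \<in> fuzzy_numbers" "v \<in> fuzzy_numbers" for u v x
    using res_in[of "left_part v x" "left_part u x"] res_in[of "right_part u x" "right_part v x"]
      part that unfolding m_def min_def by auto
  have P_le: "fuzzy_order T u v \<le> m u v x" if "u \<in> fuzzy_numbers" "v \<in> fuzzy_numbers" for u v x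
    unfolding P by (rule cINF_lower[OF bdd_belowI2[of _ 0]]) (use m_in that in auto)
  have P_in: "fuzzy_order T u v \<in> {0..1}" if "u \<in> fuzzy_numbers" "v \<in> fuzzy_numbers" for u v
  proof -
    have "0 \<le> fuzzy_order T u v"
      unfolding P by (rule cINF_greatest) (use m_in that in auto)
    moreover have "fuzzy_order T u v \<le> 1"
      using P_le[OF that, of 0] m_in[OF that, of 0] by simp
    ultimately show ?thesis by simp
  qed
  show ?thesis
    unfolding enriched_category_def
  proof (intro conjI ballI)
    fix u v assume "u \<in> fuzzy_numbers" "v \<in> fuzzy_numbers"
    then show "fuzzy_order T u v \<in> {0..1}" by (rule P_in)
  next
    fix u assume u: "u \<in> fuzzy_numbers"
    then have "m u u x = 1" for x unfolding m_def using part[OF u] res_refl by simp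
    then show "fuzzy_order T u u = 1" unfolding P by simp
  next
    fix u v w assume F: "u \<in> fuzzy_numbers" "v \<in> fuzzy_numbers" "w \<in> fuzzy_numbers"
    let ?a = "fuzzy_order T v w" and ?b = "fuzzy_order T u v"
    have ab: "?a \<in> {0..1}" "?b \<in> {0..1}" using P_in F by blast+
    have "T ?a ?b \<le> m u w x" for x
    proof -
      have "?a \<le> m v w x" "?b \<le> m u v x" using P_le F by blast+
      then have le: "?a \<le> residuum T (left_part w x) (left_part v x)"
        "?a \<le> residuum T (right_part v x) (right_part w x)"
        "?b \<le> residuum T (left_part v x) (left_part u x)"
        "?b \<le> residuum T (right_part u x) (right_part v x)"
        unfolding m_def by auto
      have "T ?a ?b \<le> residuum T (left_part w x) (left_part u x)"
        by (rule T_res[of _ "left_part v x"]) (use part F ab le in blast)+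
      moreover have "T ?b ?a \<le> residuum T (right_part u x) (right_part w x)"
        by (rule T_res[of _ "right_part v x"]) (use part F ab le in blast)+
      ultimately show ?thesis unfolding m_def using com[OF ab] by simp
    qed
    then show "T ?a ?b \<le> fuzzy_order T u w"
      unfolding P[of u w] by (intro cINF_greatest) auto
  qed
qed

definition directed_set :: "'i set \<Rightarrow> ('i \<times> 'i) set \<Rightarrow> bool" where
  "directed_set D r \<longleftrightarrow>
     D \<noteq> {} \<and> preorder_on D r \<and> (\<forall>i\<in>D. \<forall>j\<in>D. \<exists>k\<in>D. (i, k) \<in> r \<and> (j, k) \<in> r)"

definition cauchy_net ::
    "('a \<Rightarrow> 'a \<Rightarrow> real) \<Rightarrow> 'i set \<Rightarrow> ('i \<times> 'i) set \<Rightarrow> ('i \<Rightarrow> 'a) \<Rightarrow> bool" where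
  "cauchy_net hom D r s \<longleftrightarrow>
     (SUP i\<in>D. INF (j, k)\<in>{j. (i, j) \<in> r} \<times> {k. (i, k) \<in> r}. hom (s j) (s k)) = 1"

definition bilimit ::
    "'a set \<Rightarrow> ('a \<Rightarrow> 'a \<Rightarrow> real) \<Rightarrow> 'i set \<Rightarrow> ('i \<times> 'i) set \<Rightarrow> ('i \<Rightarrow> 'a) \<Rightarrow> 'a \<Rightarrow> bool" where
  "bilimit X hom D r s a \<longleftrightarrow> a \<in> X \<and>
     (\<forall>x\<in>X. (SUP i\<in>D. INF j\<in>{j. (i, j) \<in> r}. hom x (s j)) = hom x a \<and>
            (SUP i\<in>D. INF j\<in>{j. (i, j) \<in> r}. hom (s j) x) = hom a x)"

text \<open>A formula cannot quantify over all index types, so the index sets of nets range over the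
  subsets of the single type \<open>'a set \<times> 'a\<close>. Nothing is lost: the tails of a net are sets of
  points, and the net can be re-indexed by pairs of a tail and a point of that tail. The lemma
  \<open>cauchy_completeD\<close> below shows that a Cauchy complete structure has bilimits of Cauchy nets
  over directed sets in an arbitrary type \<open>'i\<close>.\<close>

definition cauchy_complete :: "'a set \<Rightarrow> ('a \<Rightarrow> 'a \<Rightarrow> real) \<Rightarrow> bool" where
  "cauchy_complete X hom \<longleftrightarrow>
     (\<forall>(D :: ('a set \<times> 'a) set) r s.
        directed_set D r \<and> s \<in> D \<rightarrow> X \<and> cauchy_net hom D r s \<longrightarrow> (\<exists>a. bilimit X hom D r s a))"

lemma cauchy_completeD:
  fixes D :: "'i set"
  assumes compl: "cauchy_complete X hom"
    and dir: "directed_set D r" and sX: "s \<in> D \<rightarrow> X" and cau: "cauchy_net hom D r s"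
  shows "\<exists>a. bilimit X hom D r s a"
proof -
  define F where "F i = s ` {j. (i, j) \<in> r}" for i
  define E where "E = {(F i, s j) | i j. (i, j) \<in> r}"
  define q where "q = {(p, p'). p \<in> E \<and> p' \<in> E \<and> fst p' \<subseteq> fst p}"
  have rD: "r \<subseteq> D \<times> D" and refl: "\<And>i. i \<in> D \<Longrightarrow> (i, i) \<in> r"
    and tr: "\<And>i j k. (i, j) \<in> r \<Longrightarrow> (j, k) \<in> r \<Longrightarrow> (i, k) \<in> r"
    using dir unfolding directed_set_def preorder_on_def refl_on_def trans_def by blast+
  have Fmono: "F j \<subseteq> F i" if "(i, j) \<in> r" for i j
    using that tr unfolding F_def by blast
  have dirE: "directed_set E q"
    unfolding directed_set_def
  proof (intro conjI ballI)
    show "E \<noteq> {}" using dir refl unfolding directed_set_def E_def by blast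
    show "preorder_on E q"
      unfolding preorder_on_def refl_on_def trans_def q_def by auto
    fix p p' assume "p \<in> E" "p' \<in> E"
    then obtain i i' where i: "i \<in> D" "fst p = F i" "i' \<in> D" "fst p' = F i'"
      unfolding E_def using rD by fastforce
    then obtain k where k: "k \<in> D" "(i, k) \<in> r" "(i', k) \<in> r"
      using dir unfolding directed_set_def by blast
    then have kE: "(F k, s k) \<in> E" unfolding E_def using refl by blast
    have "(p, (F k, s k)) \<in> q" "(p', (F k, s k)) \<in> q"
      unfolding q_def using \<open>p \<in> E\<close> \<open>p' \<in> E\<close> kE i Fmono[OF k(2)] Fmono[OF k(3)] by simp_all
    then show "\<exists>k\<in>E. (p, k) \<in> q \<and> (p', k) \<in> q"
      using kE by blast
  qed
  have sE: "snd \<in> E \<rightarrow> X" using sX rD unfolding E_def by auto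
  have tail: "snd ` {p'. (p, p') \<in> q} = F i" if p: "p \<in> E" "fst p = F i" for p i
  proof
    show "snd ` {p'. (p, p') \<in> q} \<subseteq> F i"
      using p unfolding q_def E_def F_def by auto
    show "F i \<subseteq> snd ` {p'. (p, p') \<in> q}"
    proof
      fix y assume "y \<in> F i"
      then obtain j where j: "(i, j) \<in> r" "y = s j" unfolding F_def by blast
      then have "(F i, s j) \<in> E" unfolding E_def by blast
      then have "(p, (F i, s j)) \<in> q" using p unfolding q_def by simp
      then show "y \<in> snd ` {p'. (p, p') \<in> q}" using j by force
    qed
  qed
  have fstE: "fst ` E = F ` D"
  proof
    show "fst ` E \<subseteq> F ` D" using rD unfolding E_def by auto
    show "F ` D \<subseteq> fst ` E"
    proof
      fix A assume "A \<in> F ` D"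
      then obtain i where "i \<in> D" "A = F i" by blast
      then have "(A, s i) \<in> E" unfolding E_def using refl by blast
      then show "A \<in> fst ` E" by force
    qed
  qed
  have SUP_E: "(SUP p\<in>E. h (snd ` {p'. (p, p') \<in> q})) = (SUP i\<in>D. h (F i))"
    for h :: "'a set \<Rightarrow> real"
  proof -
    have "h (snd ` {p'. (p, p') \<in> q}) = h (fst p)" if "p \<in> E" for p
    proof -
      obtain i where "fst p = F i" using \<open>p \<in> E\<close> unfolding E_def by auto
      then show ?thesis using tail[OF that] by simp
    qed
    then have "(\<lambda>p. h (snd ` {p'. (p, p') \<in> q})) ` E = (\<lambda>p. h (fst p)) ` E"
      by (intro image_cong) auto
    also have "\<dots> = h ` (fst ` E)" by (simp only: image_image)
    also have "\<dots> = (\<lambda>i. h (F i)) ` D" unfolding fstE by (simp only: image_image)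
    finally show ?thesis by simp
  qed
  have two: "(INF (j, k)\<in>A \<times> A. hom (f j) (f k)) = (INF (a, b)\<in>f ` A \<times> f ` A. hom a b)"
    for A :: "'k set" and f :: "'k \<Rightarrow> 'a"
  proof -
    have "(\<lambda>(j, k). hom (f j) (f k)) ` (A \<times> A) = (\<lambda>(a, b). hom a b) ` (f ` A \<times> f ` A)"
    proof (intro set_eqI iffI)
      fix c assume "c \<in> (\<lambda>(j, k). hom (f j) (f k)) ` (A \<times> A)"
      then obtain j k where "j \<in> A" "k \<in> A" "c = hom (f j) (f k)" by auto
      then show "c \<in> (\<lambda>(a, b). hom a b) ` (f ` A \<times> f ` A)"
        by (intro image_eqI[of _ _ "(f j, f k)"]) auto
    next
      fix c assume "c \<in> (\<lambda>(a, b). hom a b) ` (f ` A \<times> f ` A)"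
      then obtain j k where "j \<in> A" "k \<in> A" "c = hom (f j) (f k)" by auto
      then show "c \<in> (\<lambda>(j, k). hom (f j) (f k)) ` (A \<times> A)"
        by (intro image_eqI[of _ _ "(j, k)"]) auto
    qed
    then show ?thesis by (rule arg_cong)
  qed
  define h where "h A = (INF (a, b)\<in>A \<times> A. hom a b)" for A :: "'a set"
  have "cauchy_net hom E q snd"
  proof -
    have "(SUP p\<in>E. h (snd ` {p'. (p, p') \<in> q})) = 1"
      using cau unfolding SUP_E unfolding F_def h_def cauchy_net_def two[of s] .
    then show ?thesis unfolding cauchy_net_def two[of snd] h_def .
  qed
  with compl dirE sE obtain a where "bilimit X hom E q snd a"
    unfolding cauchy_complete_def by blast
  moreover have reindex: "(SUP p\<in>E. INF p'\<in>{p'. (p, p') \<in> q}. g (snd p'))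
      = (SUP i\<in>D. INF j\<in>{j. (i, j) \<in> r}. g (s j))" for g :: "'a \<Rightarrow> real"
    using SUP_E[of "\<lambda>A. INF a\<in>A. g a"] unfolding F_def by (simp only: image_image)
  ultimately have "bilimit X hom D r s a"
    unfolding bilimit_def
    using reindex[of "\<lambda>y. hom _ y"] reindex[of "\<lambda>y. hom y _"] by simp
  then show ?thesis ..
qed

end

theory Submission
  imports Defs
begin

text \<open>
  The theorem reduces to one property of the t-norm: whether \<^emph>\<open>every\<close> \<open>r < 1\<close> is a zero divisor,
  that is, whether \<open>T r s = 0\<close> for some \<open>s > 0\<close>.

  \<^emph>\<open>Completeness and zero divisors.\<close> A fuzzy number is the same as the pair of its left and right
  part, and \<open>q \<le> fuzzy_order T u v\<close> says that \<open>T q\<close> shrinks the left part of \<open>v\<close> below that of \<open>u\<close>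
  and the right part of \<open>u\<close> below that of \<open>v\<close> (\<open>le_fuzzy_order_iff\<close>). Since \<open>T q t\<close> tends to \<open>t\<close>
  uniformly as \<open>q\<close> tends to \<open>1\<close>, the parts along a Cauchy net converge uniformly. All defining
  properties of a pair of parts survive uniform limits, except that the parts vanish near
  \<open>-\<infinity>\<close> and near \<open>\<infinity>\<close>. If some \<open>r < 1\<close> is no zero divisor, then this survives as well: where a late
  member of the net vanishes, \<open>T r\<close> times the limit vanishes, hence so does the limit. If every
  \<open>r < 1\<close> is a zero divisor, then cutting off the tail of \<open>1 / (1 + x)\<close> at \<open>n\<close> gives a Cauchy sequence
  whose limit would have unbounded support.

  \<^emph>\<open>Zero divisors and the Lukasiewicz t-norm.\<close> If every \<open>r < 1\<close> is a zero divisor, then no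
  \<open>l\<close> in \<open>(0, 1)\<close> is idempotent, because an idempotent acts as a unit below itself. So the powers of
  every \<open>a < 1\<close> reach \<open>0\<close> after finitely many steps. Starting from any \<open>p 0\<close> in \<open>(0, 1)\<close> take iterated
  square roots \<open>p n\<close>; they increase to a positive idempotent, which can only be \<open>1\<close>. Declaring that the \<open>m\<close>-th power
  of \<open>p n\<close> has size \<open>m / 2 ^ n\<close> measures all of \<open>[0, 1]\<close>, and this size is a continuous strictly
  decreasing function that turns \<open>T\<close> into addition truncated at the size of \<open>0\<close>. Normalizing it gives
  the isomorphism (\<open>isomorphic_lukasiewicz_iff_zero_divisors\<close>).
\<close>

section \<open>Continuous t-norms\<close>

locale continuous_triangular_norm =
  fixes T :: "real \<Rightarrow> real \<Rightarrow> real"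
  assumes continuous_t_norm: "continuous_t_norm T"
begin

lemma
  shows T_in: "\<lbrakk>x \<in> {0..1}; y \<in> {0..1}\<rbrakk> \<Longrightarrow> T x y \<in> {0..1}"
    and T_commute: "\<lbrakk>x \<in> {0..1}; y \<in> {0..1}\<rbrakk> \<Longrightarrow> T x y = T y x"
    and T_assoc: "\<lbrakk>x \<in> {0..1}; y \<in> {0..1}; z \<in> {0..1}\<rbrakk> \<Longrightarrow> T (T x y) z = T x (T y z)"
    and T_one_right: "x \<in> {0..1} \<Longrightarrow> T x 1 = x"
    and T_mono_left: "\<lbrakk>x \<in> {0..1}; y \<in> {0..1}; z \<in> {0..1}; x \<le> y\<rbrakk> \<Longrightarrow> T x z \<le> T y z"
    and T_mono_right: "\<lbrakk>x \<in> {0..1}; y \<in> {0..1}; z \<in> {0..1}; x \<le> y\<rbrakk> \<Longrightarrow> T z x \<le> T z y"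
    and continuous_on_T: "continuous_on ({0..1} \<times> {0..1}) (\<lambda>p. T (fst p) (snd p))"
  using continuous_t_norm unfolding continuous_t_norm_def t_norm_def by blast+

lemma T_one_left: "x \<in> {0..1} \<Longrightarrow> T 1 x = x"
  using T_commute[of 1 x] T_one_right[of x] by simp

lemma T_mono:
  assumes "x \<in> {0..1}" "y \<in> {0..1}" "x' \<in> {0..1}" "y' \<in> {0..1}" "x \<le> x'" "y \<le> y'"
  shows "T x y \<le> T x' y'"
  using T_mono_left[of x x' y] T_mono_right[of y y' x'] assms by linarith

lemma T_le_left: "\<lbrakk>x \<in> {0..1}; y \<in> {0..1}\<rbrakk> \<Longrightarrow> T x y \<le> x"
  using T_mono_right[of y 1 x] T_one_right[of x] by simp

lemma T_le_right: "\<lbrakk>x \<in> {0..1}; y \<in> {0..1}\<rbrakk> \<Longrightarrow> T x y \<le> y"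
  using T_le_left[of y x] T_commute[of x y] by simp

lemma T_zero_right: "x \<in> {0..1} \<Longrightarrow> T x 0 = 0"
  using T_le_right[of x 0] T_in[of x 0] by simp

lemma T_zero_left: "x \<in> {0..1} \<Longrightarrow> T 0 x = 0"
  using T_le_left[of 0 x] T_in[of 0 x] by simp

lemma continuous_on_T_comp:
  assumes "continuous_on S f" "continuous_on S g" "f \<in> S \<rightarrow> {0..1}" "g \<in> S \<rightarrow> {0..1}"
  shows "continuous_on S (\<lambda>x. T (f x) (g x))"
proof -
  have "continuous_on S (\<lambda>x. (f x, g x))" using assms by (intro continuous_intros)
  moreover have "(\<lambda>x. (f x, g x)) ` S \<subseteq> {0..1} \<times> {0..1}" using assms by auto
  ultimately show ?thesis using continuous_on_compose2[OF continuous_on_T] by force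
qed

lemma tendsto_T:
  assumes "X \<longlonglongrightarrow> a" "Y \<longlonglongrightarrow> b" "\<And>n. X n \<in> {0..1}" "\<And>n. Y n \<in> {0..1}"
  shows "(\<lambda>n. T (X n) (Y n)) \<longlonglongrightarrow> T a b"
proof -
  have "a \<in> {0..1}" "b \<in> {0..1}"
    using assms closed_sequentially[of "{0..1}" X a] closed_sequentially[of "{0..1}" Y b] by auto
  moreover have "(\<lambda>n. (X n, Y n)) \<longlonglongrightarrow> (a, b)" using assms by (intro tendsto_intros)
  ultimately show ?thesis
    using continuous_on_tendsto_compose[OF continuous_on_T, of "\<lambda>n. (X n, Y n)" "(a, b)"] assms
    by auto
qed

text \<open>By the intermediate value theorem, the order on \<open>[0, 1]\<close> is the divisibility order.\<close>

lemma divides_of_le: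
  assumes "x \<in> {0..1}" "0 \<le> y" "y \<le> x"
  obtains t where "t \<in> {0..1}" "T x t = y"
proof -
  have "continuous_on {0..1} (T x)"
    using continuous_on_T_comp[of "{0..1}" "\<lambda>_. x" "\<lambda>t. t"] assms by auto
  then have "\<exists>t. 0 \<le> t \<and> t \<le> 1 \<and> T x t = y"
    using assms T_zero_right[of x] T_one_right[of x] by (intro IVT') auto
  then show ?thesis using that by auto
qed

lemma square_root:
  assumes "y \<in> {0..1}"
  obtains x where "x \<in> {0..1}" "T x x = y"
proof -
  have "continuous_on {0..1} (\<lambda>x. T x x)"
    by (rule continuous_on_T_comp) auto
  then have "\<exists>x. 0 \<le> x \<and> x \<le> 1 \<and> T x x = y"
    using assms T_zero_right[of 0] T_one_right[of 1] by (intro IVT') auto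
  then show ?thesis using that by auto
qed

lemma T_near_one_uniform:
  assumes "0 < e"
  obtains q where "q \<in> {0..<1}" "\<And>t. t \<in> {0..1} \<Longrightarrow> t - e < T q t"
proof -
  have "uniformly_continuous_on ({0..1} \<times> {0..1}) (\<lambda>p. T (fst p) (snd p))"
    by (intro compact_uniformly_continuous continuous_on_T compact_Times) auto
  then obtain d where "d > 0" and d: "\<And>a b. \<lbrakk>a \<in> {0..1} \<times> {0..1}; b \<in> {0..1} \<times> {0..1}; dist a b < d\<rbrakk>
      \<Longrightarrow> dist (T (fst a) (snd a)) (T (fst b) (snd b)) < e"
    unfolding uniformly_continuous_on_def using assms by (metis dist_commute)
  define q where "q = max 0 (1 - d / 2)"
  have "t - e < T q t" if "t \<in> {0..1}" for t
  proof -
    have "dist (q, t) (1, t) < d"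
      using \<open>d > 0\<close> by (simp add: dist_Pair_Pair dist_real_def q_def)
    then show ?thesis
      using d[of "(q, t)" "(1, t)"] that \<open>d > 0\<close> T_one_left[of t] by (auto simp: dist_real_def q_def)
  qed
  then show ?thesis using that[of q] \<open>d > 0\<close> by (auto simp: q_def)
qed

lemma le_if_T_near_one_le:
  assumes "t \<in> {0..1}" "\<And>q. q \<in> {0..<1} \<Longrightarrow> T q t \<le> c"
  shows "t \<le> c"
proof (rule field_le_epsilon)
  fix e :: real assume "0 < e"
  then obtain q where "q \<in> {0..<1}" "t - e < T q t" using T_near_one_uniform assms by metis
  then show "t \<le> c + e" using assms(2)[of q] by simp
qed

lemma residuum_in:
  assumes "x \<in> {0..1}" "y \<in> {0..1}"
  shows "residuum T x y \<in> {0..1}"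
proof -
  let ?W = "{w \<in> {0..1}. T x w \<le> y}"
  have "0 \<in> ?W" using assms T_zero_right by auto
  moreover have "bdd_above ?W" by (rule bdd_aboveI[of _ 1]) simp
  ultimately have "0 \<le> Sup ?W" "Sup ?W \<le> 1"
    by (auto intro: cSup_upper cSup_least)
  then show ?thesis unfolding residuum_def by simp
qed

lemma le_residuum_iff:
  assumes "x \<in> {0..1}" "y \<in> {0..1}" "w \<in> {0..1}"
  shows "w \<le> residuum T x y \<longleftrightarrow> T x w \<le> y"
proof -
  let ?W = "{w \<in> {0..1}. T x w \<le> y}"
  have ne: "0 \<in> ?W" using assms T_zero_right by auto
  have bdd: "bdd_above ?W" by (rule bdd_aboveI[of _ 1]) simp
  have "continuous_on {0..1} (T x)"
    using continuous_on_T_comp[of "{0..1}" "\<lambda>_. x" "\<lambda>t. t"] assms by auto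
  then have "closed ?W"
    by (intro continuous_on_closed_Collect_le) (auto intro: continuous_intros)
  then have "Sup ?W \<in> ?W" using closed_contains_Sup[OF _ bdd] ne by blast
  then have "T x (residuum T x y) \<le> y" unfolding residuum_def by simp
  then have "T x w \<le> y" if "w \<le> residuum T x y"
    using T_mono_right[of w "residuum T x y" x] residuum_in[of x y] assms that by simp
  moreover have "w \<le> residuum T x y" if "T x w \<le> y"
    unfolding residuum_def by (rule cSup_upper[OF _ bdd]) (use that assms in simp)
  ultimately show ?thesis by blast
qed

section \<open>Powers with respect to a t-norm\<close>

definition pow :: "real \<Rightarrow> nat \<Rightarrow> real" where
  "pow a n = (T a ^^ n) 1"

lemma pow_0 [simp]: "pow a 0 = 1"
  and pow_Suc [simp]: "pow a (Suc n) = T a (pow a n)"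
  by (simp_all add: pow_def)

lemma pow_in: "a \<in> {0..1} \<Longrightarrow> pow a n \<in> {0..1}"
proof (induction n)
  case (Suc n)
  then show ?case using T_in[of a "pow a n"] by simp
qed simp

lemma pow_add: "a \<in> {0..1} \<Longrightarrow> pow a (m + n) = T (pow a m) (pow a n)"
proof (induction m)
  case 0
  then show ?case using T_one_left pow_in by simp
next
  case (Suc m)
  then show ?case using T_assoc[of a "pow a m" "pow a n"] pow_in by simp
qed

lemma pow_pow: "a \<in> {0..1} \<Longrightarrow> pow (pow a m) n = pow a (m * n)"
proof (induction n)
  case (Suc n)
  then show ?case using pow_add[of a m "m * n"] by simp
qed simp

lemma pow_antimono:
  assumes "a \<in> {0..1}" "m \<le> n"
  shows "pow a n \<le> pow a m"
proof -
  have "pow a n = T (pow a m) (pow a (n - m))" using pow_add[of a m "n - m"] assms by simp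
  then show ?thesis using T_le_left pow_in assms by simp
qed

section \<open>Nilpotency\<close>

definition all_zero_divisors :: bool where
  "all_zero_divisors \<longleftrightarrow> (\<forall>r\<in>{0..<1}. \<exists>s\<in>{0<..1}. T r s = 0)"

text \<open>Everything below an idempotent \<open>l\<close> is a multiple of \<open>l\<close>, hence fixed by \<open>T l\<close>. So a
  positive idempotent divides no zero.\<close>

lemma idempotent_eq_zero:
  assumes zd: all_zero_divisors and l: "l \<in> {0..<1}" and idem: "T l l = l"
  shows "l = 0"
proof (rule ccontr)
  assume "l \<noteq> 0"
  obtain s where s: "s \<in> {0<..1}" "T l s = 0"
    using zd l unfolding all_zero_divisors_def by blast
  let ?s = "min s l"
  have I: "l \<in> {0..1}" "?s \<in> {0..1}" "s \<in> {0..1}" using l s by auto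
  obtain t where t: "t \<in> {0..1}" "T l t = ?s" using divides_of_le[of l ?s] I by auto
  then have "T l ?s = ?s" using T_assoc[of l l t] idem I by simp
  moreover have "T l ?s \<le> 0" using T_mono_right[of ?s s l] s I by simp
  ultimately show False using s l \<open>l \<noteq> 0\<close> by auto
qed

lemma nilpotent:
  assumes zd: all_zero_divisors and a: "a \<in> {0..<1}"
  shows "\<exists>n. pow a n = 0"
proof -
  have aI: "a \<in> {0..1}" using a by simp
  have "decseq (pow a)" using pow_antimono[OF aI] by (simp add: decseq_def)
  then obtain l where l: "pow a \<longlonglongrightarrow> l"
    using decseq_convergent[of "pow a" 0] pow_in[OF aI] by (metis atLeastAtMost_iff)
  have "(\<lambda>n. pow a (n + n)) \<longlonglongrightarrow> l"
    using LIMSEQ_subseq_LIMSEQ[OF l, of "\<lambda>n. n + n"] by (simp add: strict_mono_def comp_def)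
  moreover have "(\<lambda>n. T (pow a n) (pow a n)) \<longlonglongrightarrow> T l l"
    using tendsto_T[OF l l] pow_in[OF aI] by blast
  ultimately have "T l l = l" using pow_add[OF aI] LIMSEQ_unique by simp
  moreover have "0 \<le> l" using LIMSEQ_le_const[OF l, of 0] pow_in[OF aI] by auto
  moreover have "l \<le> a"
    using LIMSEQ_le_const2[OF l, of a] pow_antimono[OF aI, of 1] T_one_right[OF aI]
    by (metis One_nat_def pow_0 pow_Suc)
  ultimately have "l = 0" using idempotent_eq_zero[OF zd] a by auto
  \<comment> \<open>The powers only tend to zero so far; a single factor \<open>a\<close> kills all small numbers.\<close>
  obtain s where s: "s \<in> {0<..1}" "T a s = 0"
    using zd a unfolding all_zero_divisors_def by blast
  have "eventually (\<lambda>n. pow a n < s) sequentially"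
    using order_tendstoD(2)[OF l, of s] s \<open>l = 0\<close> by auto
  then obtain n where "pow a n < s" by (auto simp: eventually_sequentially)
  then have "pow a (Suc n) \<le> 0"
    using T_mono_right[of "pow a n" s a] pow_in[OF aI, of n] aI s by simp
  then show ?thesis using pow_in[OF aI, of "Suc n"] by (intro exI[of _ "Suc n"]) auto
qed

lemma T_fixed_eq_zero:
  assumes zd: all_zero_divisors and a: "a \<in> {0..<1}" and x: "x \<in> {0..1}" and fix_x: "T x a = x"
  shows "x = 0"
proof -
  have aI: "a \<in> {0..1}" using a by simp
  have "T x (pow a n) = x" for n
  proof (induction n)
    case (Suc n)
    then show ?case using T_assoc[of x a "pow a n"] fix_x pow_in[OF aI] aI x by simp
  qed (use T_one_right x in simp)
  then show ?thesis using nilpotent[OF zd a] T_zero_right[OF x] by metis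
qed

lemma ex_root_chain:
  assumes zd: all_zero_divisors
  obtains p where "\<And>n. p n \<in> {0<..<1}" "\<And>n. T (p (Suc n)) (p (Suc n)) = p n" "p \<longlonglongrightarrow> 1"
proof -
  have "\<exists>p. \<forall>n. p n \<in> {0<..<1} \<and> T (p (Suc n)) (p (Suc n)) = p n"
  proof (rule dependent_nat_choice)
    show "\<exists>x::real. x \<in> {0<..<1}" by (rule exI[of _ "1/2"]) simp
    fix y :: real and n :: nat assume y: "y \<in> {0<..<1}"
    then obtain x where x: "x \<in> {0..1}" "T x x = y" using square_root[of y] by auto
    then have "x \<noteq> 0" "x \<noteq> 1" using y T_zero_right[of 0] T_one_right[of 1] by auto
    then have "x \<in> {0<..<1}" using x(1) by simp
    then show "\<exists>x. x \<in> {0<..<1} \<and> T x x = y" using x(2) by blast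
  qed
  then obtain p where p: "\<And>n. p n \<in> {0<..<1}" and sq: "\<And>n. T (p (Suc n)) (p (Suc n)) = p n"
    by blast
  have pI: "p n \<in> {0..1}" for n using p[of n] by auto
  have inc: "incseq p"
    using T_le_left[OF pI pI] sq by (intro incseq_SucI) metis
  then obtain l where l: "p \<longlonglongrightarrow> l" using incseq_convergent[of p 1] inc pI by (metis atLeastAtMost_iff)
  have "(\<lambda>n. T (p (Suc n)) (p (Suc n))) \<longlonglongrightarrow> T l l"
    using tendsto_T[of "\<lambda>n. p (Suc n)" l] LIMSEQ_Suc[OF l] pI by blast
  then have "T l l = l" using l sq LIMSEQ_unique by simp
  moreover have "p 0 \<le> l" using incseq_le[OF inc l] .
  moreover have "l \<le> 1" using LIMSEQ_le_const2[OF l, of 1] pI by auto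
  ultimately have "l = 1" using idempotent_eq_zero[OF zd, of l] p[of 0] by fastforce
  then show ?thesis using that p sq l by blast
qed

end

section \<open>The additive size attached to a chain of square roots\<close>

locale root_chain = continuous_triangular_norm +
  fixes p :: "nat \<Rightarrow> real"
  assumes zero_divisors: all_zero_divisors
    and p_in: "\<And>n. p n \<in> {0<..<1}"
    and p_square: "\<And>n. T (p (Suc n)) (p (Suc n)) = p n"
    and p_tendsto: "p \<longlonglongrightarrow> 1"
begin

lemma p_unit: "p n \<in> {0..1}"
  using p_in[of n] by auto

lemma pow_root: "pow (p (n + k)) (2 ^ k) = p n"
proof (induction k)
  case 0
  then show ?case using T_one_right p_unit by simp
next
  case (Suc k)
  have "pow (p (n + Suc k)) 2 = p (n + k)"
    using p_square[of "n + k"] T_one_right p_unit by (simp add: numeral_2_eq_2)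
  then have "pow (p (n + Suc k)) (2 * 2 ^ k) = p n"
    using Suc pow_pow[OF p_unit, of "n + Suc k" 2 "2 ^ k"] by metis
  then show ?case by simp
qed

lemma pow_refine:
  assumes "n \<le> k"
  shows "pow (p k) (2 ^ (k - n) * m) = pow (p n) m"
  using pow_root[of n "k - n"] pow_pow[OF p_unit, of k "2 ^ (k - n)" m] assms by simp

lemma refine_fraction:
  assumes "n \<le> k"
  shows "real (2 ^ (k - n) * m) / 2 ^ k = real m / 2 ^ n"
proof -
  have "(2::real) ^ k = 2 ^ (k - n) * 2 ^ n" using assms by (simp flip: power_add)
  then show ?thesis by simp
qed

lemma pow_less_imp_less:
  assumes "pow (p k) i < pow (p k) m"
  shows "m < i"
  using pow_antimono[OF p_unit, of i m k] assms by (meson linorder_not_le)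

text \<open>Up to a scalar, this is the additive generator of the t-norm. The same power occurs under
  infinitely many fractions, so an infimum avoids any choice of representation.\<close>

definition size :: "real \<Rightarrow> real" where
  "size x = Inf {real m / 2 ^ n | m n. pow (p n) m \<le> x}"

lemma size_le:
  assumes "pow (p n) m \<le> x"
  shows "size x \<le> real m / 2 ^ n"
  unfolding size_def
proof (rule cInf_lower)
  show "bdd_below {real m / 2 ^ n | m n. pow (p n) m \<le> x}"
    by (rule bdd_belowI[of _ 0]) auto
qed (use assms in blast)

lemma size_zero_le:
  assumes "pow (p n) m = 0"
  shows "size 0 \<le> real m / 2 ^ n"
  using size_le assms by simp

text \<open>A fraction \<open>m / 2 ^ n\<close> can be expanded without changing the power that it stands for, so only
  large denominators matter.\<close>

lemma le_size:
  assumes x: "0 \<le> x" and c: "\<And>k m. \<lbrakk>N \<le> k; pow (p k) m \<le> x\<rbrakk> \<Longrightarrow> c \<le> real m / 2 ^ k"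
  shows "c \<le> size x"
  unfolding size_def
proof (rule cInf_greatest)
  obtain m where "pow (p 0) m = 0" using nilpotent[OF zero_divisors, of "p 0"] p_in[of 0] by auto
  then have "pow (p 0) m \<le> x" using x by simp
  then show "{real m / 2 ^ n | m n. pow (p n) m \<le> x} \<noteq> {}" by blast
  fix q assume "q \<in> {real m / 2 ^ n | m n. pow (p n) m \<le> x}"
  then obtain m n where q: "q = real m / 2 ^ n" "pow (p n) m \<le> x" by blast
  let ?k = "max n N"
  have "pow (p ?k) (2 ^ (?k - n) * m) \<le> x" using q pow_refine[of n ?k m] by simp
  from c[OF _ this] show "c \<le> q" using q refine_fraction[of n ?k m] by simp
qed

lemma size_nonneg: "0 \<le> x \<Longrightarrow> 0 \<le> size x"
  by (rule le_size[of _ 0]) auto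

lemma size_one: "size 1 = 0"
  using size_le[of 0 0 1] size_nonneg[of 1] by simp

lemma size_antimono:
  assumes "0 \<le> x" "x \<le> y"
  shows "size y \<le> size x"
  by (rule le_size[of _ 0]) (use assms size_le in force)+

text \<open>Any \<open>x\<close> lies between two consecutive powers of \<open>p k\<close>; the smaller one bounds its size.\<close>

lemma size_bracket:
  assumes "x \<in> {0..1}"
  obtains i where "x \<le> pow (p k) i" "size x \<le> (real i + 1) / 2 ^ k"
proof -
  obtain m where m: "pow (p k) m = 0"
    using nilpotent[OF zero_divisors, of "p k"] p_in[of k] by auto
  define j where "j = (LEAST j. pow (p k) j \<le> x)"
  have j: "pow (p k) j \<le> x"
    unfolding j_def by (rule LeastI[of _ m]) (use m assms in simp)
  show ?thesis
  proof (cases j)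
    case 0
    then have "size x \<le> 0" using size_le[OF j] by simp
    also have "0 \<le> (real 0 + 1) / 2 ^ k" by simp
    finally show ?thesis using that[of 0] assms by simp
  next
    case (Suc i)
    then have "\<not> pow (p k) i \<le> x" using not_less_Least[of i "\<lambda>j. pow (p k) j \<le> x"] j_def by simp
    then show ?thesis using that[of i] size_le[OF j] Suc by (simp add: add.commute)
  qed
qed

lemma size_T_le:
  assumes "x \<in> {0..1}" "y \<in> {0..1}"
  shows "size (T x y) \<le> size x + size y"
proof -
  have "size (T x y) - size y \<le> size x"
  proof (rule le_size[of _ 0])
    fix n m assume m: "pow (p n) m \<le> x"
    have "size (T x y) - real m / 2 ^ n \<le> size y"
    proof (rule le_size[of _ n])
      fix k l assume k: "n \<le> k" and l: "pow (p k) l \<le> y"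
      have "pow (p k) (2 ^ (k - n) * m + l) = T (pow (p n) m) (pow (p k) l)"
        using pow_add[OF p_unit] pow_refine[OF k] by simp
      also have "\<dots> \<le> T x y" using m l assms pow_in[OF p_unit] by (intro T_mono) auto
      finally have "size (T x y) \<le> real (2 ^ (k - n) * m + l) / 2 ^ k" by (rule size_le)
      also have "\<dots> = real m / 2 ^ n + real l / 2 ^ k"
        using refine_fraction[OF k, of m] by (simp add: add_divide_distrib)
      finally show "size (T x y) - real m / 2 ^ n \<le> real l / 2 ^ k" by simp
    qed (use assms in simp)
    then show "size (T x y) - size y \<le> real m / 2 ^ n" by simp
  qed (use assms in simp)
  then show ?thesis by simp
qed

text \<open>The truncation at \<open>size 0\<close> is forced: distinct exponents yield distinct powers of \<open>p k\<close> only as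
  long as the powers are not yet \<open>0\<close>.\<close>

lemma size_T_ge:
  assumes x: "x \<in> {0..1}" and y: "y \<in> {0..1}"
  shows "min (size x + size y) (size 0) \<le> size (T x y)"
proof (rule field_le_epsilon)
  fix e :: real assume "0 < e"
  then obtain N where N: "(1/2::real) ^ N < e / 2"
    using real_arch_pow_inv[of "e / 2" "1/2"] by auto
  have "min (size x + size y) (size 0) - e \<le> size (T x y)"
  proof (rule le_size[of _ N])
    show "0 \<le> T x y" using T_in[OF x y] by simp
    fix k m assume k: "N \<le> k" and m: "pow (p k) m \<le> T x y"
    show "min (size x + size y) (size 0) - e \<le> real m / 2 ^ k"
    proof (cases "pow (p k) m = 0")
      case True
      then show ?thesis using size_zero_le[OF True] \<open>0 < e\<close> by linarith
    next
      case False
      obtain i where i: "x \<le> pow (p k) i" "size x \<le> (real i + 1) / 2 ^ k" using size_bracket[OF x] .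
      obtain j where j: "y \<le> pow (p k) j" "size y \<le> (real j + 1) / 2 ^ k" using size_bracket[OF y] .
      have "i + j \<le> m"
      proof (rule ccontr)
        assume "\<not> i + j \<le> m"
        then have less: "Suc m \<le> i + j" by simp
        have "pow (p k) m \<le> pow (p k) (i + j)"
          using m T_mono[of x y "pow (p k) i" "pow (p k) j"] x y i j pow_in[OF p_unit]
            pow_add[OF p_unit] by fastforce
        also have "\<dots> \<le> pow (p k) (Suc m)" using pow_antimono[OF p_unit less] .
        also have "\<dots> = T (pow (p k) m) (p k)" using T_commute pow_in[OF p_unit] p_unit by simp
        finally have "T (pow (p k) m) (p k) = pow (p k) m"
          using T_le_left[OF pow_in[OF p_unit] p_unit, of k m k] by linarith
        then have "pow (p k) m = 0"
          using T_fixed_eq_zero[OF zero_divisors, of "p k" "pow (p k) m"] p_in[of k]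
            pow_in[OF p_unit, of k m] by simp
        with False show False ..
      qed
      then have "real i + real j \<le> real m" by linarith
      then have "(real i + real j) / 2 ^ k \<le> real m / 2 ^ k" by (rule divide_right_mono) simp
      then have "(real i + 1) / 2 ^ k + (real j + 1) / 2 ^ k \<le> real m / 2 ^ k + 2 * (1/2) ^ k"
        by (simp add: add_divide_distrib power_one_over)
      moreover have "(1/2::real) ^ k \<le> (1/2) ^ N" using k by (intro power_decreasing) auto
      ultimately show ?thesis using i(2) j(2) N by linarith
    qed
  qed
  then show "min (size x + size y) (size 0) \<le> size (T x y) + e" by simp
qed

lemma size_T:
  assumes "x \<in> {0..1}" "y \<in> {0..1}"
  shows "size (T x y) = min (size x + size y) (size 0)"
  using size_T_le[OF assms] size_T_ge[OF assms] size_antimono[of 0 "T x y"] T_in[OF assms]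
  by (simp add: min_def split: if_splits)

text \<open>Between \<open>x < y\<close> there is room for one more factor \<open>p n\<close>, provided that \<open>n\<close> is large; this
  separates the sizes by \<open>1 / 2 ^ n\<close>.\<close>

lemma size_strict_antimono:
  assumes "0 \<le> x" "x < y" "y \<le> 1"
  shows "size y < size x"
proof -
  have y: "y \<in> {0..1}" using assms by simp
  have "(\<lambda>n. T y (p n)) \<longlonglongrightarrow> T y 1" using tendsto_T[of "\<lambda>_. y" y p 1] p_tendsto p_unit y by simp
  then have "eventually (\<lambda>n. x < T y (p n)) sequentially"
    using order_tendstoD(1) assms T_one_right[OF y] by fastforce
  then obtain n where n: "x < T y (p n)" by (auto simp: eventually_sequentially)
  have "size y + 1 / 2 ^ n \<le> size x"
  proof (rule le_size[of _ n])
    fix k m assume k: "n \<le> k" and m: "pow (p k) m \<le> x"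
    obtain i where i: "y \<le> pow (p k) i" "size y \<le> (real i + 1) / 2 ^ k" using size_bracket[OF y] .
    have pn: "pow (p k) (2 ^ (k - n)) = p n"
      using pow_refine[OF k, of 1] T_one_right p_unit by simp
    have "pow (p k) m < T y (p n)" using m n by simp
    also have "\<dots> \<le> pow (p k) (i + 2 ^ (k - n))"
      using pow_add[OF p_unit] pn T_mono_left i y pow_in[OF p_unit] p_unit by simp
    finally have "i + 2 ^ (k - n) < m" by (rule pow_less_imp_less)
    then have "real (i + 1 + 2 ^ (k - n)) \<le> real m" by linarith
    then have "real (i + 1 + 2 ^ (k - n)) / 2 ^ k \<le> real m / 2 ^ k" by (rule divide_right_mono) simp
    moreover have "real (i + 1 + 2 ^ (k - n)) / 2 ^ k = (real i + 1) / 2 ^ k + 1 / 2 ^ n"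
      using refine_fraction[OF k, of 1] by (simp add: add_divide_distrib)
    ultimately show "size y + 1 / 2 ^ n \<le> real m / 2 ^ k" using i by linarith
  qed (use assms in simp)
  moreover have "(0::real) < 1 / 2 ^ n" by simp
  ultimately show ?thesis by linarith
qed

text \<open>Multiplication by \<open>p n\<close> changes the size by at most \<open>1 / 2 ^ n\<close>, and it moves \<open>x\<close> strictly
  down, past all points near \<open>x\<close>. At \<open>x = 0\<close>, where it cannot move strictly down, it sends a whole
  neighbourhood to \<open>0\<close> instead.\<close>

lemma T_root_nhd:
  assumes x: "x \<in> {0..1}"
  obtains d where "d > 0" "\<And>z. \<lbrakk>z \<in> {0..1}; \<bar>z - x\<bar> < d\<rbrakk> \<Longrightarrow> T z (p n) \<le> x \<and> T x (p n) \<le> z"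
proof (cases "x = 0")
  case True
  obtain s where s: "s \<in> {0<..1}" "T (p n) s = 0"
    using zero_divisors p_in[of n] unfolding all_zero_divisors_def by fastforce
  show ?thesis
  proof (rule that[of s])
    fix z assume z: "z \<in> {0..1}" "\<bar>z - x\<bar> < s"
    then have "T z (p n) \<le> T s (p n)" using True s p_unit by (intro T_mono_left) auto
    then show "T z (p n) \<le> x \<and> T x (p n) \<le> z"
      using True s z T_commute[of s "p n"] p_unit[of n] T_zero_left[of "p n"] by auto
  qed (use s in simp)
next
  case False
  have less: "T x (p n) < x"
    using T_fixed_eq_zero[OF zero_divisors, of "p n" x] p_in[of n] x False
      T_le_left[OF x p_unit, of n] by fastforce
  have "continuous_on {0..1} (\<lambda>z. T z (p n))"
    using p_unit by (intro continuous_on_T_comp) auto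
  then obtain d where d: "d > 0"
      "\<And>z. \<lbrakk>z \<in> {0..1}; dist z x < d\<rbrakk> \<Longrightarrow> dist (T z (p n)) (T x (p n)) < x - T x (p n)"
    unfolding continuous_on_iff using x less by (metis diff_gt_0_iff_gt)
  show ?thesis
  proof (rule that[of "min d (x - T x (p n))"])
    fix z assume z: "z \<in> {0..1}" "\<bar>z - x\<bar> < min d (x - T x (p n))"
    then show "T z (p n) \<le> x \<and> T x (p n) \<le> z"
      using d(2)[of z] by (auto simp: dist_real_def)
  qed (use d less in simp)
qed

lemma continuous_on_size: "continuous_on {0..1} size"
  unfolding continuous_on_iff
proof (intro ballI allI impI)
  fix x e :: real assume x: "x \<in> {0..1}" and "0 < e"
  then obtain n where n: "(1/2::real) ^ n < e"
    using real_arch_pow_inv[of e "1/2"] by auto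
  obtain d where d: "d > 0"
      "\<And>z. \<lbrakk>z \<in> {0..1}; \<bar>z - x\<bar> < d\<rbrakk> \<Longrightarrow> T z (p n) \<le> x \<and> T x (p n) \<le> z"
    using T_root_nhd[OF x] by metis
  have step: "size b \<le> size a + (1/2) ^ n" if "a \<in> {0..1}" "T a (p n) \<le> b" for a b
  proof -
    have "size b \<le> size (T a (p n))" using T_in[OF that(1) p_unit] that by (intro size_antimono) auto
    also have "\<dots> \<le> size a + size (p n)" using size_T_le that p_unit by blast
    also have "size (p n) \<le> (1/2) ^ n"
      using size_le[of n 1 "p n"] T_one_right p_unit by (simp add: power_one_over)
    finally show ?thesis by simp
  qed
  show "\<exists>d>0. \<forall>z\<in>{0..1}. dist z x < d \<longrightarrow> dist (size z) (size x) < e"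
  proof (intro exI[of _ d] conjI ballI impI)
    fix z assume z: "z \<in> {0..1}" "dist z x < d"
    then have "size x \<le> size z + (1/2) ^ n" "size z \<le> size x + (1/2) ^ n"
      using d(2)[of z] step x by (auto simp: dist_real_def)
    then show "dist (size z) (size x) < e" using n by (simp add: dist_real_def abs_le_iff)
  qed (use d in simp)
qed

theorem isomorphic_lukasiewicz: "isomorphic_lukasiewicz T"
proof -
  define \<phi> where "\<phi> x = 1 - size x / size 0" for x
  have pos: "0 < size 0" using size_strict_antimono[of 0 1] size_one by simp
  have \<phi>0: "\<phi> 0 = 0" and \<phi>1: "\<phi> 1 = 1" using pos size_one by (simp_all add: \<phi>_def)
  have sm: "strict_mono_on {0..1} \<phi>"
    using size_strict_antimono pos
    by (auto simp: \<phi>_def strict_mono_on_def divide_strict_right_mono)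
  have cont: "continuous_on {0..1} \<phi>"
    unfolding \<phi>_def using pos by (intro continuous_intros continuous_on_size) auto
  have "\<phi> ` {0..1} = {0..1}"
  proof
    have "\<phi> x \<in> {0..1}" if "x \<in> {0..1}" for x
      using size_antimono[of 0 x] size_nonneg[of x] pos that by (simp add: \<phi>_def)
    then show "\<phi> ` {0..1} \<subseteq> {0..1}" by blast
    show "{0..1} \<subseteq> \<phi> ` {0..1}"
    proof
      fix y :: real assume "y \<in> {0..1}"
      then have "\<exists>x. 0 \<le> x \<and> x \<le> 1 \<and> \<phi> x = y" using cont \<phi>0 \<phi>1 by (intro IVT') auto
      then show "y \<in> \<phi> ` {0..1}" by auto
    qed
  qed
  then have "bij_betw \<phi> {0..1} {0..1}"
    using strict_mono_on_imp_inj_on[OF sm] by (simp add: bij_betw_def)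
  moreover have "\<phi> (T a b) = lukasiewicz (\<phi> a) (\<phi> b)" if "a \<in> {0..1}" "b \<in> {0..1}" for a b
  proof -
    have "min (size a + size b) (size 0) / size 0 = min ((size a + size b) / size 0) 1"
      using pos by (auto simp: min_def)
    then show ?thesis
      unfolding \<phi>_def lukasiewicz_def size_T[OF that] by (simp add: add_divide_distrib)
  qed
  ultimately show ?thesis using sm unfolding isomorphic_lukasiewicz_def by blast
qed

end

theorem (in continuous_triangular_norm) isomorphic_lukasiewicz_iff_zero_divisors:
  "isomorphic_lukasiewicz T \<longleftrightarrow> all_zero_divisors"
proof
  assume all_zero_divisors
  moreover obtain p where "\<And>n. p n \<in> {0<..<1}" "\<And>n. T (p (Suc n)) (p (Suc n)) = p n" "p \<longlonglongrightarrow> 1"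
    using ex_root_chain[OF calculation] by metis
  ultimately interpret root_chain T p by unfold_locales
  show "isomorphic_lukasiewicz T" by (rule isomorphic_lukasiewicz)
next
  assume "isomorphic_lukasiewicz T"
  then obtain \<phi> where bij: "bij_betw \<phi> {0..1} {0..1}" and sm: "strict_mono_on {0..1} \<phi>"
    and hom: "\<And>a b. \<lbrakk>a \<in> {0..1}; b \<in> {0..1}\<rbrakk> \<Longrightarrow> \<phi> (T a b) = lukasiewicz (\<phi> a) (\<phi> b)"
    unfolding isomorphic_lukasiewicz_def by blast
  have range: "\<phi> x \<in> {0..1}" if "x \<in> {0..1}" for x
    using bij that by (auto simp: bij_betw_def)
  have surj: "\<exists>x\<in>{0..1}. \<phi> x = y" if "y \<in> {0..1}" for y
    using bij that unfolding bij_betw_def by (metis imageE)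
  have \<phi>0: "\<phi> 0 = 0"
  proof -
    obtain z where z: "z \<in> {0..1}" "\<phi> z = 0" using surj[of 0] by auto
    then show ?thesis using strict_mono_onD[OF sm, of 0 z] range[of 0] by (cases "z = 0") auto
  qed
  show all_zero_divisors
    unfolding all_zero_divisors_def
  proof
    fix r :: real assume r: "r \<in> {0..<1}"
    have "\<phi> r < 1" using strict_mono_onD[OF sm, of r 1] r range[of 1] by auto
    obtain s where s: "s \<in> {0..1}" "\<phi> s = 1 - \<phi> r" using surj[of "1 - \<phi> r"] range[of r] r by auto
    have "s \<noteq> 0" using s \<phi>0 \<open>\<phi> r < 1\<close> by auto
    have "\<phi> (T r s) = \<phi> 0" using hom[of r s] r s \<phi>0 by (simp add: lukasiewicz_def)
    then have "T r s = 0"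
      using strict_mono_onD[OF sm, of 0 "T r s"] T_in[of r s] r s by (cases "T r s = 0") auto
    then show "\<exists>s\<in>{0<..1}. T r s = 0" using s \<open>s \<noteq> 0\<close> by (intro bexI[of _ s]) auto
  qed
qed

section \<open>Fuzzy numbers as pairs of parts\<close>

text \<open>The intrinsic description of the pairs \<open>(left_part u, right_part u)\<close>. Every condition is stated
  so that it passes to uniform limits, except for the two on supports. In particular, the
  existence of a common point of value \<open>1\<close> is encoded by the disjunction, which is pointwise.\<close>

definition fuzzy_parts :: "(real \<Rightarrow> real) \<Rightarrow> (real \<Rightarrow> real) \<Rightarrow> bool" where
  "fuzzy_parts f g \<longleftrightarrow>
     (\<forall>x. f x \<in> {0..1} \<and> g x \<in> {0..1}) \<and> mono f \<and> antimono g \<and>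
     upper_semicontinuous f \<and> upper_semicontinuous g \<and>
     (\<forall>x. f x = 1 \<or> g x = 1) \<and>
     (\<exists>A. \<forall>x<A. f x = 0) \<and> (\<exists>B. \<forall>x>B. g x = 0)"

lemma fuzzy_number_outside_support:
  assumes u: "u \<in> fuzzy_numbers" and x: "x < Inf (level0 u) \<or> Sup (level0 u) < x"
  shows "u x = 0"
proof (rule ccontr)
  assume "u x \<noteq> 0"
  moreover have "0 \<le> u x" using u unfolding fuzzy_numbers_def by auto
  ultimately have "x \<in> level0 u" unfolding level0_def using closure_subset[of "{x. 0 < u x}"] by auto
  then have "x \<in> {Inf (level0 u)..Sup (level0 u)}"
    by (rule subsetD[OF equalityD1[OF level0_eq_interval[OF u]]])
  with x show False by auto
qed

lemma fuzzy_parts_of_fuzzy_number: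
  assumes u: "u \<in> fuzzy_numbers"
  shows "fuzzy_parts (left_part u) (right_part u)"
proof -
  define a where "a = Inf (level1 u)"
  have range: "0 \<le> u x" "u x \<le> 1" for x using u unfolding fuzzy_numbers_def by auto
  have usc: "upper_semicontinuous u" using u unfolding fuzzy_numbers_def by blast
  have ua: "u a = 1"
  proof -
    obtain z where "z \<in> level1 u" using level1_nonempty[OF u] by blast
    then have "z \<in> {a..Sup (level1 u)}"
      unfolding a_def by (rule subsetD[OF equalityD1[OF level1_eq_interval[OF u]]])
    then have "a \<in> {a..Sup (level1 u)}" by simp
    then have "a \<in> level1 u"
      unfolding a_def by (rule subsetD[OF equalityD2[OF level1_eq_interval[OF u]]])
    then show ?thesis by (simp add: level1_def)
  qed
  note outside = fuzzy_number_outside_support[OF u]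
  have "Inf (level0 u) \<le> a" using outside[of a] ua by force
  then have L: "left_part u x = (if x < a then u x else 1)" for x
    using outside[of x] ua unfolding left_part_def a_def
    by (cases "x = Inf (level1 u)") auto
  have R: "right_part u x = (if x < a then 1 else u x)" for x
    using outside[of x] unfolding right_part_def a_def by auto
  have between: "min (u x) (u z) \<le> u y" if "x \<le> y" "y \<le> z" for x y z
  proof (cases "x = z")
    case False
    define l where "l = (z - y) / (z - x)"
    have "l \<in> {0..1}" using that False by (auto simp: l_def divide_simps)
    then have "min (u x) (u z) \<le> u (l * x + (1 - l) * z)"
      using u unfolding fuzzy_numbers_def by blast
    moreover have "l * (z - x) = z - y" using False by (simp add: l_def)
    then have "l * x + (1 - l) * z = y" by (simp add: algebra_simps)
    ultimately show ?thesis by simp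
  qed (use that in simp)
  show ?thesis
    unfolding fuzzy_parts_def
  proof (intro conjI allI)
    fix x
    show "left_part u x \<in> {0..1}" "right_part u x \<in> {0..1}"
      unfolding L R using range[of x] by simp_all
    show "left_part u x = 1 \<or> right_part u x = 1" unfolding L R by simp
  next
    show "mono (left_part u)"
    proof (rule monoI)
      fix x y :: real assume "x \<le> y"
      then show "left_part u x \<le> left_part u y"
        unfolding L using between[of x y a] range[of x] ua by auto
    qed
    show "antimono (right_part u)"
    proof (rule antimonoI)
      fix x y :: real assume "x \<le> y"
      then show "right_part u y \<le> right_part u x"
        unfolding R using between[of a x y] range[of y] ua by auto
    qed
    show "upper_semicontinuous (left_part u)"
      unfolding upper_semicontinuous_def
    proof (intro allI impI)
      fix x c assume c: "left_part u x < c"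
      show "\<forall>\<^sub>F y in nhds x. left_part u y < c"
      proof (cases "x < a")
        case True
        then have "\<forall>\<^sub>F y in nhds x. y < a" using eventually_nhds_in_open[of "{..<a}" x] by simp
        moreover have "\<forall>\<^sub>F y in nhds x. u y < c"
          using usc c True unfolding upper_semicontinuous_def L by simp
        ultimately show ?thesis unfolding L by eventually_elim simp
      next
        case False
        then show ?thesis using c range unfolding L by (auto intro!: always_eventually intro: le_less_trans)
      qed
    qed
    show "upper_semicontinuous (right_part u)"
      unfolding upper_semicontinuous_def
    proof (intro allI impI)
      fix x c assume c: "right_part u x < c"
      show "\<forall>\<^sub>F y in nhds x. right_part u y < c"
      proof (cases "a < x")
        case True
        then have "\<forall>\<^sub>F y in nhds x. a < y" using eventually_nhds_in_open[of "{a<..}" x] by simp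
        moreover have "\<forall>\<^sub>F y in nhds x. u y < c"
          using usc c True unfolding upper_semicontinuous_def R by simp
        ultimately show ?thesis unfolding R by eventually_elim simp
      next
        case False
        then have "1 < c" using c ua unfolding R by (cases "x = a") auto
        then show ?thesis
          using range unfolding R by (auto intro!: always_eventually intro: le_less_trans)
      qed
    qed
    show "\<exists>A. \<forall>x<A. left_part u x = 0"
      by (rule exI[of _ "Inf (level0 u)"]) (simp add: left_part_def)
    show "\<exists>B. \<forall>x>B. right_part u x = 0"
      by (rule exI[of _ "max a (Sup (level0 u))"]) (simp add: right_part_def a_def)
  qed
qed

lemma upper_semicontinuous_le:
  assumes usc: "upper_semicontinuous f" and freq: "\<And>e. e > 0 \<Longrightarrow> \<exists>y. dist y x < e \<and> c \<le> f y"
  shows "c \<le> f x"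
proof (rule ccontr)
  assume "\<not> c \<le> f x"
  then have "\<forall>\<^sub>F y in nhds x. f y < c" using usc by (simp add: upper_semicontinuous_def)
  then obtain e where "e > 0" "\<And>y. dist y x < e \<Longrightarrow> f y < c" by (auto simp: eventually_nhds_metric)
  then show False using freq[of e] by force
qed

text \<open>The first point where the left part reaches \<open>1\<close> works. It exists because the left part must be
  \<open>1\<close> wherever the right part vanishes; and the right part is \<open>1\<close> before that point, hence at that point by semicontinuity.\<close>

lemma fuzzy_parts_common_one:
  assumes "fuzzy_parts f g"
  obtains a where "f a = 1" "g a = 1" "\<And>x. f x = 1 \<Longrightarrow> a \<le> x"
proof -
  have range: "f x \<le> 1" "g x \<le> 1" for x using assms unfolding fuzzy_parts_def by auto
  have m: "mono f" and uf: "upper_semicontinuous f" and ug: "upper_semicontinuous g"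
    and disj: "\<And>x. f x = 1 \<or> g x = 1" using assms unfolding fuzzy_parts_def by auto
  obtain A B where A: "\<And>x. x < A \<Longrightarrow> f x = 0" and B: "\<And>x. x > B \<Longrightarrow> g x = 0"
    using assms unfolding fuzzy_parts_def by auto
  define a where "a = Inf {x. f x = 1}"
  have ne: "{x. f x = 1} \<noteq> {}" using disj[of "B + 1"] B[of "B + 1"] by auto
  have bdd: "bdd_below {x. f x = 1}"
    using A by (intro bdd_belowI[of _ A]) (metis linorder_not_less mem_Collect_eq zero_neq_one)
  have least: "a \<le> x" if "f x = 1" for x unfolding a_def using that bdd by (simp add: cInf_lower)
  have "1 \<le> f a"
  proof (rule upper_semicontinuous_le[OF uf])
    fix e :: real assume "e > 0"
    then obtain y where "f y = 1" "y < a + e"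
      using cInf_lessD[OF ne, of "a + e"] unfolding a_def by auto
    then show "\<exists>y. dist y a < e \<and> 1 \<le> f y"
      using least[of y] by (intro exI[of _ y]) (auto simp: dist_real_def)
  qed
  moreover have "1 \<le> g a"
  proof (rule upper_semicontinuous_le[OF ug])
    fix e :: real assume "e > 0"
    then have "f (a - e / 2) \<noteq> 1" using least[of "a - e / 2"] by auto
    then show "\<exists>y. dist y a < e \<and> 1 \<le> g y"
      using disj[of "a - e / 2"] \<open>e > 0\<close> by (intro exI[of _ "a - e / 2"]) (auto simp: dist_real_def)
  qed
  ultimately show ?thesis using that[of a] range least by (simp add: antisym)
qed

lemma fuzzy_number_of_fuzzy_parts:
  assumes fg: "fuzzy_parts f g"
  obtains u where "u \<in> fuzzy_numbers" "left_part u = f" "right_part u = g"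
proof -
  have range: "0 \<le> f x" "f x \<le> 1" "0 \<le> g x" "g x \<le> 1" for x
    using fg unfolding fuzzy_parts_def by auto
  have m: "mono f" and am: "antimono g" and uf: "upper_semicontinuous f"
    and ug: "upper_semicontinuous g" using fg unfolding fuzzy_parts_def by auto
  obtain A B where A: "\<And>x. x < A \<Longrightarrow> f x = 0" and B: "\<And>x. x > B \<Longrightarrow> g x = 0"
    using fg unfolding fuzzy_parts_def by auto
  obtain a where a: "f a = 1" "g a = 1" and least: "\<And>x. f x = 1 \<Longrightarrow> a \<le> x"
    using fuzzy_parts_common_one[OF fg] by metis
  have f1: "f x = 1" if "a \<le> x" for x using monoD[OF m that] a range[of x] by simp
  have g1: "g x = 1" if "x \<le> a" for x using antimonoD[OF am that] a range[of x] by simp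
  define u where "u x = min (f x) (g x)" for x
  have u: "u \<in> fuzzy_numbers"
    unfolding fuzzy_numbers_def
  proof (intro CollectI conjI allI ballI)
    fix x show "u x \<in> {0..1}" using range[of x] by (simp add: u_def)
  next
    show "\<exists>x. u x = 1" using a by (intro exI[of _ a]) (simp add: u_def)
  next
    fix x y l :: real assume "l \<in> {0..1}"
    then have "l * x + (1 - l) * y \<in> {min x y..max x y}"
      using convex_bound_le[of x "max x y" y l "1 - l"] convex_bound_le[of "-x" "- min x y" "-y" l "1 - l"]
      by simp
    then show "min (u x) (u y) \<le> u (l * x + (1 - l) * y)"
      using monoD[OF m, of "min x y" "l * x + (1 - l) * y"]
        antimonoD[OF am, of "l * x + (1 - l) * y" "max x y"]
      unfolding u_def by (cases "x \<le> y") auto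
  next
    show "upper_semicontinuous u"
      unfolding upper_semicontinuous_def
    proof (intro allI impI)
      fix x c assume "u x < c"
      then consider "f x < c" | "g x < c" unfolding u_def by linarith
      then show "\<forall>\<^sub>F y in nhds x. u y < c"
      proof cases
        case 1
        then have "\<forall>\<^sub>F y in nhds x. f y < c" using uf unfolding upper_semicontinuous_def by blast
        then show ?thesis by eventually_elim (simp add: u_def)
      next
        case 2
        then have "\<forall>\<^sub>F y in nhds x. g y < c" using ug unfolding upper_semicontinuous_def by blast
        then show ?thesis by eventually_elim (simp add: u_def)
      qed
    qed
  next
    have "{x. 0 < u x} \<subseteq> {A..B}"
      using A B by (auto simp: u_def) (metis linorder_not_less less_irrefl)+
    then show "compact (level0 u)"
      unfolding level0_def by (meson bounded_closed_interval bounded_subset compact_closure)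
  qed
  have Inf1: "Inf (level1 u) = a"
  proof (rule cInf_eq_minimum)
    show "a \<in> level1 u" using a by (simp add: level1_def u_def)
    fix x assume "x \<in> level1 u"
    then show "a \<le> x" using least range[of x] by (auto simp: level1_def u_def min_def split: if_splits)
  qed
  note u0 = fuzzy_number_outside_support[OF u]
  have "Inf (level0 u) \<le> a" using u0[of a] a by (force simp: u_def)
  then have "left_part u x = f x" for x
    using u0[of x] f1[of x] g1[of x] range[of x] unfolding left_part_def Inf1
    by (cases "x < a") (auto simp: u_def min_def split: if_splits)
  moreover have "right_part u x = g x" for x
    using u0[of x] f1[of x] g1[of x] range[of x] unfolding right_part_def Inf1
    by (cases "x < a") (auto simp: u_def min_def split: if_splits)
  ultimately show ?thesis using that u by blast
qed

lemma upper_semicontinuous_uniform_limit: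
  assumes approx: "\<And>e. 0 < e \<Longrightarrow> \<exists>h. upper_semicontinuous h \<and> (\<forall>x. \<bar>h x - H x\<bar> \<le> e)"
  shows "upper_semicontinuous H"
  unfolding upper_semicontinuous_def
proof (intro allI impI)
  fix x c assume "H x < c"
  define e where "e = (c - H x) / 3"
  have "0 < e" using \<open>H x < c\<close> by (simp add: e_def)
  then obtain h where h: "upper_semicontinuous h" "\<And>x. \<bar>h x - H x\<bar> \<le> e" using approx by blast
  have "3 * e = c - H x" by (simp add: e_def)
  then have "h x < c - e" using h(2)[of x] \<open>0 < e\<close> unfolding abs_le_iff by linarith
  then have "\<forall>\<^sub>F y in nhds x. h y < c - e" using h(1) unfolding upper_semicontinuous_def by blast
  then show "\<forall>\<^sub>F y in nhds x. H y < c"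
  proof eventually_elim
    case (elim y)
    then show ?case using h(2)[of y] by (simp add: abs_le_iff)
  qed
qed

lemma mono_uniform_limit:
  fixes H :: "real \<Rightarrow> real"
  assumes approx: "\<And>e. 0 < e \<Longrightarrow> \<exists>h. mono h \<and> (\<forall>x. \<bar>h x - H x\<bar> \<le> e)"
  shows "mono H"
proof (rule monoI, rule field_le_epsilon)
  fix x y e :: real assume "x \<le> y" "0 < e"
  then obtain h where h: "mono h" "\<And>x. \<bar>h x - H x\<bar> \<le> e / 2" using approx[of "e / 2"] by auto
  show "H x \<le> H y + e"
    using monoD[OF h(1) \<open>x \<le> y\<close>] h(2)[of x] h(2)[of y] unfolding abs_le_iff by linarith
qed

lemma fuzzy_parts_uniform_limit:
  assumes range: "\<And>x. f x \<in> {0..1} \<and> g x \<in> {0..1}"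
    and approx: "\<And>e. 0 < e \<Longrightarrow> \<exists>h k. fuzzy_parts h k \<and> (\<forall>x. \<bar>h x - f x\<bar> \<le> e \<and> \<bar>k x - g x\<bar> \<le> e)"
    and support: "\<exists>A. \<forall>x<A. f x = 0" "\<exists>B. \<forall>x>B. g x = 0"
  shows "fuzzy_parts f g"
proof -
  have *: "\<exists>h k. mono h \<and> antimono k \<and> upper_semicontinuous h \<and> upper_semicontinuous k \<and>
      (\<forall>x. h x = 1 \<or> k x = 1) \<and> (\<forall>x. \<bar>h x - f x\<bar> \<le> e) \<and> (\<forall>x. \<bar>k x - g x\<bar> \<le> e)"
    if e: "0 < e" for e
  proof -
    obtain h k where hk: "fuzzy_parts h k" "\<forall>x. \<bar>h x - f x\<bar> \<le> e \<and> \<bar>k x - g x\<bar> \<le> e"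
      using approx[OF e] by blast
    show ?thesis
      by (rule exI[of _ h], rule exI[of _ k]) (use hk in \<open>simp add: fuzzy_parts_def\<close>)
  qed
  have "mono f"
    by (rule mono_uniform_limit) (use * in meson)
  moreover have "mono (\<lambda>x. - g x)"
  proof (rule mono_uniform_limit)
    fix e :: real assume "0 < e"
    then obtain k where "antimono k" "\<And>x. \<bar>k x - g x\<bar> \<le> e"
      using * by meson
    then show "\<exists>h. mono h \<and> (\<forall>x. \<bar>h x - - g x\<bar> \<le> e)"
      by (intro exI[of _ "\<lambda>x. - k x"]) (auto simp: mono_def antimono_def abs_le_iff)
  qed
  then have "antimono g" by (auto simp: mono_def antimono_def)
  moreover have "upper_semicontinuous f" "upper_semicontinuous g"
    by (rule upper_semicontinuous_uniform_limit, use * in meson)+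
  moreover have "f x = 1 \<or> g x = 1" for x
  proof (rule ccontr)
    assume ne: "\<not> (f x = 1 \<or> g x = 1)"
    define e where "e = min (1 - f x) (1 - g x) / 2"
    have "0 < e" using ne range[of x] by (auto simp: e_def less_le)
    then obtain h k where "h x = 1 \<or> k x = 1" "\<bar>h x - f x\<bar> \<le> e" "\<bar>k x - g x\<bar> \<le> e"
      using * by meson
    then show False using \<open>0 < e\<close> by (auto simp: e_def abs_le_iff min_def split: if_splits)
  qed
  ultimately show ?thesis using range support unfolding fuzzy_parts_def by blast
qed

section \<open>Nets in enriched categories\<close>

lemma directed_setD:
  assumes "directed_set D r"
  shows "D \<noteq> {}" "\<And>i j. (i, j) \<in> r \<Longrightarrow> i \<in> D \<and> j \<in> D" "\<And>i. i \<in> D \<Longrightarrow> (i, i) \<in> r"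
    "\<And>i j k. \<lbrakk>(i, j) \<in> r; (j, k) \<in> r\<rbrakk> \<Longrightarrow> (i, k) \<in> r"
    "\<And>i j. \<lbrakk>i \<in> D; j \<in> D\<rbrakk> \<Longrightarrow> \<exists>k\<in>D. (i, k) \<in> r \<and> (j, k) \<in> r"
  using assms unfolding directed_set_def preorder_on_def refl_on_def trans_def by blast+

lemma INF_unit_in:
  fixes h :: "'i \<Rightarrow> real"
  assumes "A \<noteq> {}" "\<And>j. j \<in> A \<Longrightarrow> h j \<in> {0..1}"
  shows "(INF j\<in>A. h j) \<in> {0..1}"
proof -
  have "0 \<le> (INF j\<in>A. h j)" using assms by (intro cINF_greatest) auto
  moreover obtain j where "j \<in> A" using assms by blast
  then have "(INF j\<in>A. h j) \<le> h j" using assms by (intro cINF_lower bdd_belowI2[of _ 0]) auto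
  ultimately show ?thesis using assms(2)[OF \<open>j \<in> A\<close>] by auto
qed

lemma INF_unit_lower:
  fixes h :: "'i \<Rightarrow> real"
  assumes "\<And>j. j \<in> A \<Longrightarrow> h j \<in> {0..1}" "j \<in> A"
  shows "(INF j\<in>A. h j) \<le> h j"
  using assms by (intro cINF_lower bdd_belowI2[of _ 0]) auto

lemma SUP_unit_upper:
  fixes h :: "'i \<Rightarrow> real"
  assumes "\<And>j. j \<in> A \<Longrightarrow> h j \<in> {0..1}" "j \<in> A"
  shows "h j \<le> (SUP j\<in>A. h j)"
  using assms by (intro cSUP_upper bdd_aboveI2[of _ _ 1]) auto

lemma SUP_unit_in:
  fixes h :: "'i \<Rightarrow> real"
  assumes "A \<noteq> {}" "\<And>j. j \<in> A \<Longrightarrow> h j \<in> {0..1}"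
  shows "(SUP j\<in>A. h j) \<in> {0..1}"
proof -
  have "(SUP j\<in>A. h j) \<le> 1" using assms by (intro cSUP_least) auto
  moreover obtain j where "j \<in> A" using assms by blast
  then have "h j \<le> (SUP j\<in>A. h j)" using SUP_unit_upper[of A h j] assms by blast
  ultimately show ?thesis using assms(2)[OF \<open>j \<in> A\<close>] by auto
qed

lemma SUP_unit_eq_one_iff:
  fixes h :: "'i \<Rightarrow> real"
  assumes "A \<noteq> {}" "\<And>j. j \<in> A \<Longrightarrow> h j \<in> {0..1}"
  shows "(SUP j\<in>A. h j) = 1 \<longleftrightarrow> (\<forall>q\<in>{0..<1}. \<exists>j\<in>A. q \<le> h j)"
proof
  assume one: "(SUP j\<in>A. h j) = 1"
  show "\<forall>q\<in>{0..<1}. \<exists>j\<in>A. q \<le> h j"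
  proof
    fix q :: real assume "q \<in> {0..<1}"
    then have "q < (SUP j\<in>A. h j)" using one by simp
    then show "\<exists>j\<in>A. q \<le> h j"
      using less_cSUP_iff[of A h q] assms by (force intro: bdd_aboveI2[of _ _ 1])
  qed
next
  assume q: "\<forall>q\<in>{0..<1}. \<exists>j\<in>A. q \<le> h j"
  have "1 \<le> (SUP j\<in>A. h j)"
  proof (rule dense_le_bounded[of 0])
    fix q :: real assume "0 < q" "q < 1"
    then obtain j where "j \<in> A" "q \<le> h j" using q by force
    then show "q \<le> (SUP j\<in>A. h j)" using SUP_unit_upper[of A h j] assms by fastforce
  qed simp
  then show "(SUP j\<in>A. h j) = 1" using SUP_unit_in[of A h] assms by force
qed

lemma cauchy_net_iff:
  assumes dir: "directed_set D r" and hom: "\<And>j k. \<lbrakk>j \<in> D; k \<in> D\<rbrakk> \<Longrightarrow> hom (s j) (s k) \<in> {0..1}"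
  shows "cauchy_net hom D r s \<longleftrightarrow>
    (\<forall>q\<in>{0..<1}. \<exists>i\<in>D. \<forall>j k. (i, j) \<in> r \<longrightarrow> (i, k) \<in> r \<longrightarrow> q \<le> hom (s j) (s k))"
proof -
  note d = directed_setD[OF dir]
  define tail where "tail i = {j. (i, j) \<in> r} \<times> {k. (i, k) \<in> r}" for i
  define g where "g = (\<lambda>(j, k). hom (s j) (s k))"
  have tail: "tail i \<noteq> {}" if "i \<in> D" for i using d(3)[OF that] by (auto simp: tail_def)
  have g: "g jk \<in> {0..1}" if "jk \<in> tail i" for i jk
    using that hom d(2) by (fastforce simp: tail_def g_def)
  have le: "q \<le> (INF jk\<in>tail i. g jk) \<longleftrightarrow>
      (\<forall>j k. (i, j) \<in> r \<longrightarrow> (i, k) \<in> r \<longrightarrow> q \<le> hom (s j) (s k))" if "i \<in> D" for i q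
  proof -
    have "bdd_below (g ` tail i)" using g by (intro bdd_belowI2[of _ 0]) auto
    from le_cINF_iff[OF tail[OF that] this] show ?thesis by (auto simp: tail_def g_def)
  qed
  have "(INF jk\<in>tail i. g jk) \<in> {0..1}" if "i \<in> D" for i using INF_unit_in[OF tail[OF that] g] .
  from SUP_unit_eq_one_iff[OF d(1) this] show ?thesis
    unfolding cauchy_net_def using le by (simp add: tail_def g_def)
qed

context continuous_triangular_norm
begin

text \<open>If a tail of a net in \<open>[0, 1]\<close> varies by at most a factor \<open>q\<close>, then its limit inferior is within
  the same factor of every member of that tail.\<close>

lemma limit_inferior_close:
  fixes h :: "'i \<Rightarrow> real"
  assumes dir: "directed_set D r" and h: "\<And>j. j \<in> D \<Longrightarrow> h j \<in> {0..1}"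
    and i: "i \<in> D" and q: "q \<in> {0..1}"
    and close: "\<And>j k. \<lbrakk>(i, j) \<in> r; (i, k) \<in> r\<rbrakk> \<Longrightarrow> T q (h j) \<le> h k"
    and j: "(i, j) \<in> r"
  defines "H \<equiv> (SUP i\<in>D. INF j\<in>{j. (i, j) \<in> r}. h j)"
  shows "T q (h j) \<le> H" "T q H \<le> h j"
proof -
  note d = directed_setD[OF dir]
  have tail: "{j. (i, j) \<in> r} \<noteq> {}" "\<And>j. j \<in> {j. (i, j) \<in> r} \<Longrightarrow> h j \<in> {0..1}" if "i \<in> D" for i
    using d(3)[OF that] d(2) h by blast+
  have inf_in: "(INF j\<in>{j. (i, j) \<in> r}. h j) \<in> {0..1}" if "i \<in> D" for i
    using INF_unit_in[OF tail[OF that]] .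
  have H: "H \<in> {0..1}" unfolding H_def using SUP_unit_in[OF d(1) inf_in] .
  have hj: "h j \<in> {0..1}" using d(2) j h by blast
  have "T q (h j) \<le> (INF k\<in>{k. (i, k) \<in> r}. h k)"
    using tail[OF i] close[OF j] by (intro cINF_greatest) auto
  also have "\<dots> \<le> H" unfolding H_def using SUP_unit_upper[OF inf_in i] .
  finally show "T q (h j) \<le> H" .
  have "H \<le> residuum T q (h j)"
    unfolding H_def
  proof (rule cSUP_least[OF d(1)])
    fix l assume l: "l \<in> D"
    then obtain k where k: "k \<in> D" "(i, k) \<in> r" "(l, k) \<in> r" using d(5)[OF i] by blast
    have "(INF j\<in>{j. (l, j) \<in> r}. h j) \<le> h k"
      by (rule INF_unit_lower[OF tail(2)[OF l]]) (use k in simp_all)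
    also have "\<dots> \<le> residuum T q (h j)"
      using le_residuum_iff[OF q hj h[OF k(1)]] close[OF k(2) j] by blast
    finally show "(INF j\<in>{j. (l, j) \<in> r}. h j) \<le> residuum T q (h j)" .
  qed
  then show "T q H \<le> h j" using le_residuum_iff[OF q hj H] by blast
qed

text \<open>Closeness up to factors \<open>q < 1\<close> determines the limit inferior, because \<open>T q\<close> tends to the
  identity as \<open>q\<close> tends to \<open>1\<close>.\<close>

lemma SUP_INF_eqI:
  fixes h :: "'i \<Rightarrow> real"
  assumes dir: "directed_set D r" and h: "\<And>j. j \<in> D \<Longrightarrow> h j \<in> {0..1}" and c: "c \<in> {0..1}"
    and close: "\<And>q. q \<in> {0..<1} \<Longrightarrow> \<exists>i\<in>D. \<forall>j. (i, j) \<in> r \<longrightarrow> T q (h j) \<le> c \<and> T q c \<le> h j"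
  shows "(SUP i\<in>D. INF j\<in>{j. (i, j) \<in> r}. h j) = c" (is "?S = c")
proof (rule antisym)
  note d = directed_setD[OF dir]
  have tail: "{j. (i, j) \<in> r} \<noteq> {}" "\<And>j. j \<in> {j. (i, j) \<in> r} \<Longrightarrow> h j \<in> {0..1}" if "i \<in> D" for i
    using d(3)[OF that] d(2) h by blast+
  have inf_in: "(INF j\<in>{j. (i, j) \<in> r}. h j) \<in> {0..1}" if "i \<in> D" for i
    using INF_unit_in[OF tail[OF that]] .
  show "?S \<le> c"
  proof (rule cSUP_least[OF d(1)])
    fix l assume l: "l \<in> D"
    show "(INF j\<in>{j. (l, j) \<in> r}. h j) \<le> c"
    proof (rule le_if_T_near_one_le[OF inf_in[OF l]])
      fix q :: real assume q: "q \<in> {0..<1}"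
      obtain i where i: "i \<in> D" "\<And>j. (i, j) \<in> r \<Longrightarrow> T q (h j) \<le> c" using close[OF q] by blast
      obtain k where k: "k \<in> D" "(i, k) \<in> r" "(l, k) \<in> r" using d(5)[OF i(1) l] by blast
      have "(INF j\<in>{j. (l, j) \<in> r}. h j) \<le> h k"
        by (rule INF_unit_lower[OF tail(2)[OF l]]) (use k in simp_all)
      then have "T q (INF j\<in>{j. (l, j) \<in> r}. h j) \<le> T q (h k)"
        using q h[OF k(1)] inf_in[OF l] by (intro T_mono_right) auto
      also have "\<dots> \<le> c" using i k by blast
      finally show "T q (INF j\<in>{j. (l, j) \<in> r}. h j) \<le> c" .
    qed
  qed
  show "c \<le> ?S"
  proof (rule le_if_T_near_one_le[OF c])
    fix q :: real assume q: "q \<in> {0..<1}"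
    obtain i where i: "i \<in> D" "\<And>j. (i, j) \<in> r \<Longrightarrow> T q c \<le> h j" using close[OF q] by blast
    have "T q c \<le> (INF j\<in>{j. (i, j) \<in> r}. h j)"
      using tail[OF i(1)] i(2) by (intro cINF_greatest) auto
    also have "\<dots> \<le> ?S" using SUP_unit_upper[OF inf_in i(1)] .
    finally show "T q c \<le> ?S" .
  qed
qed

text \<open>A point that is asymptotically isomorphic to the net is a bilimit: composing with
  the almost invertible morphisms between it and the net costs only a factor close to \<open>1\<close>.\<close>

lemma bilimitI:
  assumes enr: "enriched_category T X hom" and dir: "directed_set D r" and s: "s \<in> D \<rightarrow> X" and a: "a \<in> X"
    and close: "\<And>q. q \<in> {0..<1} \<Longrightarrow>
      \<exists>i\<in>D. \<forall>j. (i, j) \<in> r \<longrightarrow> q \<le> hom (s j) a \<and> q \<le> hom a (s j)"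
  shows "bilimit X hom D r s a"
  unfolding bilimit_def
proof (intro conjI ballI)
  have hom: "hom x y \<in> {0..1}" if "x \<in> X" "y \<in> X" for x y
    using enr that unfolding enriched_category_def by blast
  have comp: "T (hom y z) (hom x y) \<le> hom x z" if "x \<in> X" "y \<in> X" "z \<in> X" for x y z
    using enr that unfolding enriched_category_def by blast
  have sX: "s j \<in> X" if "j \<in> D" for j using s that by blast
  note d = directed_setD[OF dir]
  fix x assume x: "x \<in> X"
  have pre: "T q (hom x y) \<le> hom x z" if "y \<in> X" "z \<in> X" "q \<in> {0..<1}" "q \<le> hom y z" for q y z
    using T_mono_left[of q "hom y z" "hom x y"] comp[of x y z] hom x that by fastforce
  have post: "T q (hom y x) \<le> hom z x" if "y \<in> X" "z \<in> X" "q \<in> {0..<1}" "q \<le> hom z y" for q y z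
  proof -
    have "T q (hom y x) \<le> T (hom z y) (hom y x)"
      using hom[OF that(2,1)] hom[OF that(1) x] that by (intro T_mono_left) auto
    also have "\<dots> = T (hom y x) (hom z y)"
      using hom[OF that(2,1)] hom[OF that(1) x] by (rule T_commute)
    also have "\<dots> \<le> hom z x" using comp[of z y x] that x by blast
    finally show ?thesis .
  qed
  show "(SUP i\<in>D. INF j\<in>{j. (i, j) \<in> r}. hom x (s j)) = hom x a"
  proof (rule SUP_INF_eqI[OF dir])
    fix q :: real assume q: "q \<in> {0..<1}"
    then obtain i where "i \<in> D" "\<And>j. (i, j) \<in> r \<Longrightarrow> q \<le> hom (s j) a \<and> q \<le> hom a (s j)"
      using close by blast
    then show "\<exists>i\<in>D. \<forall>j. (i, j) \<in> r \<longrightarrow> T q (hom x (s j)) \<le> hom x a \<and> T q (hom x a) \<le> hom x (s j)"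
      using pre q a sX d(2) by blast
  qed (use hom x a sX in blast)+
  show "(SUP i\<in>D. INF j\<in>{j. (i, j) \<in> r}. hom (s j) x) = hom a x"
  proof (rule SUP_INF_eqI[OF dir])
    fix q :: real assume q: "q \<in> {0..<1}"
    then obtain i where "i \<in> D" "\<And>j. (i, j) \<in> r \<Longrightarrow> q \<le> hom (s j) a \<and> q \<le> hom a (s j)"
      using close by blast
    then show "\<exists>i\<in>D. \<forall>j. (i, j) \<in> r \<longrightarrow> T q (hom (s j) x) \<le> hom a x \<and> T q (hom a x) \<le> hom (s j) x"
      using post q a sX d(2) by blast
  qed (use hom x a sX in blast)+
qed (rule a)

lemma bilimitD:
  assumes enr: "enriched_category T X hom" and dir: "directed_set D r" and s: "s \<in> D \<rightarrow> X"
    and lim: "bilimit X hom D r s a" and q: "q \<in> {0..<1}"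
  shows "\<exists>i\<in>D. \<forall>j. (i, j) \<in> r \<longrightarrow> q \<le> hom (s j) a"
proof -
  note d = directed_setD[OF dir]
  have a: "a \<in> X" using lim unfolding bilimit_def by blast
  have hom: "hom (s j) a \<in> {0..1}" if "j \<in> D" for j
    using enr a s that unfolding enriched_category_def by blast
  have tail: "{j. (i, j) \<in> r} \<noteq> {}" "\<And>j. j \<in> {j. (i, j) \<in> r} \<Longrightarrow> hom (s j) a \<in> {0..1}"
    if "i \<in> D" for i
    using d(3)[OF that] d(2) hom by blast+
  have "(SUP i\<in>D. INF j\<in>{j. (i, j) \<in> r}. hom (s j) a) = 1"
    using lim a enr unfolding bilimit_def enriched_category_def by simp
  moreover have "(INF j\<in>{j. (i, j) \<in> r}. hom (s j) a) \<in> {0..1}" if "i \<in> D" for i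
    using INF_unit_in[OF tail[OF that]] .
  ultimately have "\<forall>q\<in>{0..<1}. \<exists>i\<in>D. q \<le> (INF j\<in>{j. (i, j) \<in> r}. hom (s j) a)"
    using SUP_unit_eq_one_iff[OF d(1), of "\<lambda>i. INF j\<in>{j. (i, j) \<in> r}. hom (s j) a"] by blast
  then obtain i where i: "i \<in> D" "q \<le> (INF j\<in>{j. (i, j) \<in> r}. hom (s j) a)"
    using q by blast
  have "q \<le> hom (s j) a" if "(i, j) \<in> r" for j
  proof -
    have "(INF j\<in>{j. (i, j) \<in> r}. hom (s j) a) \<le> hom (s j) a"
      by (rule INF_unit_lower[OF tail(2)[OF i(1)]]) (use that in simp_all)
    then show ?thesis using i(2) by linarith
  qed
  then show ?thesis using i(1) by blast
qed

section \<open>Completeness of the fuzzy numbers\<close>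

lemma part_in:
  assumes "u \<in> fuzzy_numbers"
  shows "left_part u x \<in> {0..1}" "right_part u x \<in> {0..1}"
  using fuzzy_parts_of_fuzzy_number[OF assms] unfolding fuzzy_parts_def by blast+

lemma le_fuzzy_order_iff:
  assumes u: "u \<in> fuzzy_numbers" and v: "v \<in> fuzzy_numbers" and q: "q \<in> {0..1}"
  shows "q \<le> fuzzy_order T u v \<longleftrightarrow>
    (\<forall>x. T q (left_part v x) \<le> left_part u x \<and> T q (right_part u x) \<le> right_part v x)"
proof -
  define m where "m x = min (residuum T (left_part v x) (left_part u x))
      (residuum T (right_part u x) (right_part v x))" for x
  have "m x \<in> {0..1}" for x
    unfolding m_def using residuum_in part_in[OF u] part_in[OF v] by (auto simp: min_def)
  then have "bdd_below (range m)" by (intro bdd_belowI2[of _ 0]) auto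
  then have "q \<le> fuzzy_order T u v \<longleftrightarrow> (\<forall>x. q \<le> m x)"
    unfolding fuzzy_order_def m_def[symmetric] by (simp add: le_cINF_iff)
  moreover have "q \<le> m x \<longleftrightarrow> T q (left_part v x) \<le> left_part u x \<and> T q (right_part u x) \<le> right_part v x" for x
    unfolding m_def using part_in[OF u, of x] part_in[OF v, of x] q le_residuum_iff T_commute[of q]
    by simp
  ultimately show ?thesis by simp
qed

text \<open>The limit is formed pointwise on the parts. A single \<open>r0 < 1\<close> that is no zero divisor
  confines its support to that of one late member of the net.\<close>

lemma cauchy_complete_if_no_zero_divisor:
  assumes nzd: "\<not> all_zero_divisors"
  shows "cauchy_complete fuzzy_numbers (fuzzy_order T)"
  unfolding cauchy_complete_def
proof (intro allI impI, elim conjE)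
  fix D :: "((real \<Rightarrow> real) set \<times> (real \<Rightarrow> real)) set" and r s
  assume dir: "directed_set D r" and s: "s \<in> D \<rightarrow> fuzzy_numbers"
    and cau: "cauchy_net (fuzzy_order T) D r s"
  note enr = enriched_category_fuzzy_numbers[OF continuous_t_norm]
  note d = directed_setD[OF dir]
  have sF: "s j \<in> fuzzy_numbers" if "j \<in> D" for j using s that by blast
  define f where "f x = (SUP i\<in>D. INF j\<in>{j. (i, j) \<in> r}. left_part (s j) x)" for x
  define g where "g x = (SUP i\<in>D. INF j\<in>{j. (i, j) \<in> r}. right_part (s j) x)" for x
  have range: "f x \<in> {0..1} \<and> g x \<in> {0..1}" for x
    unfolding f_def g_def using d(2,3) part_in[OF sF]
    by (intro conjI SUP_unit_in[OF d(1)] INF_unit_in) blast+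
  have close: "\<exists>i\<in>D. \<forall>j x. (i, j) \<in> r \<longrightarrow>
      T q (left_part (s j) x) \<le> f x \<and> T q (f x) \<le> left_part (s j) x \<and>
      T q (right_part (s j) x) \<le> g x \<and> T q (g x) \<le> right_part (s j) x"
    if q: "q \<in> {0..<1}" for q
  proof -
    have "fuzzy_order T (s j) (s k) \<in> {0..1}" if "j \<in> D" "k \<in> D" for j k
      using enr sF that unfolding enriched_category_def by blast
    then obtain i where i: "i \<in> D"
        "\<And>j k. \<lbrakk>(i, j) \<in> r; (i, k) \<in> r\<rbrakk> \<Longrightarrow> q \<le> fuzzy_order T (s j) (s k)"
      using cau cauchy_net_iff[OF dir, of "fuzzy_order T" s] q by blast
    have qI: "q \<in> {0..1}" using q by auto
    have "T q (left_part (s k) x) \<le> left_part (s j) x" "T q (right_part (s j) x) \<le> right_part (s k) x"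
      if "(i, j) \<in> r" "(i, k) \<in> r" for j k x
      using i(2)[OF that] le_fuzzy_order_iff[OF sF sF qI, of j k] that d(2) by blast+
    then have "T q (left_part (s j) x) \<le> f x" "T q (f x) \<le> left_part (s j) x"
        "T q (right_part (s j) x) \<le> g x" "T q (g x) \<le> right_part (s j) x"
      if "(i, j) \<in> r" for j x
      using limit_inferior_close[OF dir, of "\<lambda>j. left_part (s j) x" i q j]
        limit_inferior_close[OF dir, of "\<lambda>j. right_part (s j) x" i q j]
        part_in[OF sF] i(1) qI that unfolding f_def g_def by simp_all
    then show ?thesis using i(1) by blast
  qed
  obtain r0 where r0: "r0 \<in> {0..<1}" and pos: "\<And>t. t \<in> {0<..1} \<Longrightarrow> T r0 t \<noteq> 0"
    using nzd unfolding all_zero_divisors_def by blast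
  obtain i0 where i0: "i0 \<in> D"
      "\<And>x. T r0 (f x) \<le> left_part (s i0) x" "\<And>x. T r0 (g x) \<le> right_part (s i0) x"
    using close[OF r0] d(3) by blast
  have zero: "t = 0" if "t \<in> {0..1}" "T r0 t \<le> 0" for t
    using pos[of t] T_in[of r0 t] r0 that by fastforce
  have "fuzzy_parts f g"
  proof (rule fuzzy_parts_uniform_limit[OF range])
    obtain A B where "\<And>x. x < A \<Longrightarrow> left_part (s i0) x = 0" "\<And>x. x > B \<Longrightarrow> right_part (s i0) x = 0"
      using fuzzy_parts_of_fuzzy_number[OF sF[OF i0(1)]] unfolding fuzzy_parts_def by blast
    then show "\<exists>A. \<forall>x<A. f x = 0" "\<exists>B. \<forall>x>B. g x = 0"
      using zero range i0(2,3) by metis+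
    fix e :: real assume "0 < e"
    then obtain q where q: "q \<in> {0..<1}" "\<And>t. t \<in> {0..1} \<Longrightarrow> t - e < T q t"
      using T_near_one_uniform by metis
    obtain i where i: "i \<in> D" "\<And>x. T q (left_part (s i) x) \<le> f x \<and> T q (f x) \<le> left_part (s i) x \<and>
      T q (right_part (s i) x) \<le> g x \<and> T q (g x) \<le> right_part (s i) x"
      using close[OF q(1)] d(3) by blast
    have "\<bar>left_part (s i) x - f x\<bar> \<le> e \<and> \<bar>right_part (s i) x - g x\<bar> \<le> e" for x
      using i(2)[of x] q(2)[of "f x"] q(2)[of "g x"] q(2)[of "left_part (s i) x"]
        q(2)[of "right_part (s i) x"] range[of x] part_in[OF sF[OF i(1)], of x]
      unfolding abs_le_iff by (intro conjI; linarith)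
    then show "\<exists>h k. fuzzy_parts h k \<and> (\<forall>x. \<bar>h x - f x\<bar> \<le> e \<and> \<bar>k x - g x\<bar> \<le> e)"
      using fuzzy_parts_of_fuzzy_number[OF sF[OF i(1)]] by blast
  qed
  then obtain a where a: "a \<in> fuzzy_numbers" "left_part a = f" "right_part a = g"
    using fuzzy_number_of_fuzzy_parts by metis
  have "bilimit fuzzy_numbers (fuzzy_order T) D r s a"
  proof (rule bilimitI[OF enr dir s a(1)])
    fix q :: real assume q: "q \<in> {0..<1}"
    then have "q \<in> {0..1}" by simp
    then show "\<exists>i\<in>D. \<forall>j. (i, j) \<in> r \<longrightarrow> q \<le> fuzzy_order T (s j) a \<and> q \<le> fuzzy_order T a (s j)"
      using close[OF q] le_fuzzy_order_iff[OF sF a(1)] le_fuzzy_order_iff[OF a(1) sF] a(2,3) d(2)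
      by (metis (no_types, lifting))
  qed
  then show "\<exists>a. bilimit fuzzy_numbers (fuzzy_order T) D r s a" by blast
qed

text \<open>Cut off the tail of \<open>1 / (1 + x)\<close> at \<open>n\<close>. The cut-off tails become small, so that any given
  \<open>q < 1\<close> annihilates them; hence the sequence is Cauchy although its limit has no
  bounded support.\<close>

lemma not_cauchy_complete_if_zero_divisors:
  assumes zd: all_zero_divisors
  shows "\<not> cauchy_complete fuzzy_numbers (fuzzy_order T)"
proof
  assume compl: "cauchy_complete fuzzy_numbers (fuzzy_order T)"
  note enr = enriched_category_fuzzy_numbers[OF continuous_t_norm]
  define f :: "real \<Rightarrow> real" where "f x = (if x < 0 then 0 else 1)" for x
  define g :: "nat \<Rightarrow> real \<Rightarrow> real" where
    "g n x = (if x < 0 then 1 else if x \<le> real n then 1 / (1 + x) else 0)" for n x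
  have "fuzzy_parts f (g n)" for n
    unfolding fuzzy_parts_def
  proof (intro conjI allI)
    fix x show "f x \<in> {0..1}" "g n x \<in> {0..1}" "f x = 1 \<or> g n x = 1"
      by (auto simp: f_def g_def divide_simps)
  next
    show "mono f" by (auto simp: f_def mono_def)
    show "antimono (g n)" by (auto simp: g_def antimono_def divide_simps)
    show "upper_semicontinuous f"
      unfolding upper_semicontinuous_def
    proof (intro allI impI)
      fix x c assume c: "f x < c"
      show "\<forall>\<^sub>F y in nhds x. f y < c"
      proof (cases "x < 0")
        case True
        then have "\<forall>\<^sub>F y in nhds x. y < 0" using eventually_nhds_in_open[of "{..<0}" x] by simp
        then show ?thesis by eventually_elim (use c True in \<open>simp add: f_def\<close>)
      qed (use c in \<open>auto simp: f_def\<close>)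
    qed
    show "upper_semicontinuous (g n)"
      unfolding upper_semicontinuous_def
    proof (intro allI impI)
      fix x c assume c: "g n x < c"
      have "0 \<le> g n x" by (simp add: g_def)
      then have pos_c: "0 < c" using c by linarith
      consider "x \<le> 0" | "0 < x" "x \<le> real n" | "real n < x" by linarith
      then show "\<forall>\<^sub>F y in nhds x. g n y < c"
      proof cases
        case 1
        then have "1 < c" using c by (cases "x = 0") (auto simp: g_def)
        moreover have "g n y \<le> 1" for y by (auto simp: g_def divide_simps)
        ultimately show ?thesis by (auto intro!: always_eventually intro: le_less_trans)
      next
        case 2
        have "((\<lambda>y. 1 / (1 + y)) \<longlongrightarrow> 1 / (1 + x)) (nhds x)"
          using 2 by (auto intro!: tendsto_eq_intros filterlim_ident)
        then have "\<forall>\<^sub>F y in nhds x. 1 / (1 + y) < c"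
          using order_tendstoD(2) c 2 by (fastforce simp: g_def)
        moreover have "\<forall>\<^sub>F y in nhds x. 0 < y"
          using 2 eventually_nhds_in_open[of "{0<..}" x] by simp
        ultimately show ?thesis by eventually_elim (use pos_c in \<open>simp add: g_def\<close>)
      next
        case 3
        then have "\<forall>\<^sub>F y in nhds x. real n < y"
          using eventually_nhds_in_open[of "{real n<..}" x] by simp
        then show ?thesis by eventually_elim (use pos_c in \<open>auto simp: g_def\<close>)
      qed
    qed
    show "\<exists>A. \<forall>x<A. f x = 0" by (rule exI[of _ 0]) (simp add: f_def)
    show "\<exists>B. \<forall>x>B. g n x = 0" by (rule exI[of _ "real n"]) (simp add: g_def)
  qed
  then have "\<exists>v. v \<in> fuzzy_numbers \<and> left_part v = f \<and> right_part v = g n" for n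
    using fuzzy_number_of_fuzzy_parts by blast
  then obtain u where u: "\<And>n. u n \<in> fuzzy_numbers" "\<And>n. left_part (u n) = f"
      "\<And>n. right_part (u n) = g n"
    by metis
  have fI: "f x \<in> {0..1}" and gI: "g n x \<in> {0..1}" for n x
    by (auto simp: f_def g_def divide_simps)
  define R where "R = {(m, n :: nat). m \<le> n}"
  have dir: "directed_set UNIV R"
    unfolding directed_set_def preorder_on_def refl_on_def trans_def R_def
    by (auto intro: max.cobounded1 max.cobounded2)
  have uF: "u \<in> UNIV \<rightarrow> fuzzy_numbers" using u by blast
  have hom: "fuzzy_order T (u m) (u n) \<in> {0..1}" for m n
    using enr u(1) unfolding enriched_category_def by blast
  have "cauchy_net (fuzzy_order T) UNIV R u"
    unfolding cauchy_net_iff[OF dir, of "fuzzy_order T" u, OF hom]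
  proof
    fix q :: real assume q: "q \<in> {0..<1}"
    then have qI: "q \<in> {0..1}" by simp
    obtain t where t: "t \<in> {0<..1}" "T q t = 0" using zd q unfolding all_zero_divisors_def by blast
    obtain i :: nat where i: "1 / t < real i" using reals_Archimedean2 by blast
    have "q \<le> fuzzy_order T (u j) (u k)" if "i \<le> j" "i \<le> k" for j k
    proof -
      have "T q (g j x) \<le> g k x" for x
      proof (cases "g j x \<le> g k x")
        case True
        then show ?thesis using T_le_right[OF qI gI, of j x] by linarith
      next
        case False
        \<comment> \<open>The two functions differ only past the earlier cut, where both are at most \<open>t\<close>.\<close>
        then have x: "real k < x" "g j x \<le> 1 / (1 + x)" "0 \<le> x"
          by (auto simp: g_def split: if_splits)
        have "1 / t < 1 + x" using i x that by linarith
        then have "1 / (1 + x) \<le> t" using t x by (simp add: field_simps)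
        then have "T q (g j x) \<le> T q t" using x t qI gI by (intro T_mono_right) auto
        then show ?thesis using t gI[of k x] by simp
      qed
      then show ?thesis
        using le_fuzzy_order_iff[OF u(1) u(1) qI] u T_le_right[OF qI fI] by simp
    qed
    then show "\<exists>i\<in>UNIV. \<forall>j k. (i, j) \<in> R \<longrightarrow> (i, k) \<in> R \<longrightarrow> q \<le> fuzzy_order T (u j) (u k)"
      by (intro bexI[of _ i]) (auto simp: R_def)
  qed
  then obtain a where lim: "bilimit fuzzy_numbers (fuzzy_order T) UNIV R u a"
    using cauchy_completeD[OF compl dir uF] by blast
  then have a: "a \<in> fuzzy_numbers" unfolding bilimit_def by blast
  obtain B where B: "\<And>x. x > B \<Longrightarrow> right_part a x = 0"
    using fuzzy_parts_of_fuzzy_number[OF a] unfolding fuzzy_parts_def by blast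
  define x where "x = max 0 (B + 1)"
  have "1 / (1 + x) \<le> 0"
  proof (rule le_if_T_near_one_le)
    show "1 / (1 + x) \<in> {0..1}" by (auto simp: x_def divide_simps)
    fix q :: real assume q: "q \<in> {0..<1}"
    then obtain i where i: "\<And>j. (i, j) \<in> R \<Longrightarrow> q \<le> fuzzy_order T (u j) a"
      using bilimitD[OF enr dir uF lim] by blast
    define j where "j = max i (nat \<lceil>x\<rceil>)"
    have "T q (right_part (u j) x) \<le> right_part a x"
      using i[of j] le_fuzzy_order_iff[OF u(1) a, of q j] q by (simp add: R_def j_def)
    moreover have "x \<le> real j" unfolding j_def by (simp add: le_max_iff_disj of_nat_max real_nat_ceiling_ge)
    ultimately show "T q (1 / (1 + x)) \<le> 0" using u(3) B[of x] by (simp add: g_def x_def)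
  qed
  moreover have "0 < 1 / (1 + x)" by (simp add: x_def)
  ultimately show False by simp
qed

end

theorem theorem4p11:
  fixes T :: "real \<Rightarrow> real \<Rightarrow> real"
  assumes "continuous_t_norm T"
  shows "cauchy_complete fuzzy_numbers (fuzzy_order T) \<longleftrightarrow> \<not> isomorphic_lukasiewicz T"
proof -
  interpret continuous_triangular_norm T by unfold_locales (rule assms)
  show ?thesis
    using isomorphic_lukasiewicz_iff_zero_divisors cauchy_complete_if_no_zero_divisor
      not_cauchy_complete_if_zero_divisors by blast
qed

end
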